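(* Let $\mathcal{H}_L,\mathcal{H}_S$ be finite-dimensional Hilbert spaces with $\dim\mathcal{H}_L=d_L$. Let $\mathcal{E}$ be an encoding channel from $L$ to $S$ and $\mathcal{N}$ a noise channel from $S$ to $S$ of the form $$\mathcal{E}(\rho)=\sum_{s=1}^{m}E_s\rho E_s^{\dagger},\qquad \mathcal{N}(\sigma)=\sum_{i=1}^{n}A_i\sigma A_i^{\dagger},$$ where $\sum_{s=1}^{m}E_s^{\dagger}E_s=\mathbf{1}_L$ and $\sum_{i=1}^{n}A_i^{\dagger}A_i=\mathbf{1}_S$. Define $O=\sum_{s=1}^{m}E_sE_s^{\dagger}$. Then $$f_e(\mathcal{N}\circ\mathcal{E})\geq 1-\epsilon(\mathcal{N}\circ\mathcal{E}),$$ where $$\epsilon(\mathcal{N}\circ\mathcal{E})=\sqrt{\frac{mn}{4d_L}}\left(\sum_{i,j=1}^{n}\mathrm{tr}\left(A_i^{\dagger}A_jOA_j^{\dagger}A_iO\right)-\frac{1}{d_L}\sum_{i,j=1}^{n}\sum_{s,t=1}^{m}\left|\mathrm{tr}\left(A_i^{\dagger}A_jE_tE_s^{\dagger}\right)\right|^2\right)^{1/2}.$$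
   Context: A channel is a completely positive trace-preserving linear map; all Hilbert spaces are finite-dimensional. Let $R$ be a reference system identical to $L$, and let $|\psi\rangle_{LR}=\frac{1}{\sqrt{d_L}}\sum_{k=1}^{d_L}|k\rangle_L|k\rangle_R$ be the maximally entangled state. For a channel $\Lambda$ on $L$, the entanglement fidelity is $$F_e(\Lambda)=\sqrt{\langle\psi|_{LR}\,(\Lambda_L\otimes\mathcal{I}_R)(|\psi\rangle\langle\psi|_{LR})\,|\psi\rangle_{LR}},$$ where $\mathcal{I}_R$ is the identity channel on $R$. The performance of the encoding $\mathcal{E}$ under the noise $\mathcal{N}$ is $$f_e(\mathcal{N}\circ\mathcal{E})=\max_{\mathcal{R}}F_e(\mathcal{R}\circ\mathcal{N}\circ\mathcal{E}),$$ the maximum being over all (recovery) channels $\mathcal{R}$ from $S$ to $L$. The quantity $\epsilon$ is called the infidelity; it is defined in terms of the given Kraus operators. *)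

theory Defs
  imports "HOL-Analysis.Analysis"
begin

text \<open>
  Finite-dimensional Hilbert spaces are the coordinate spaces \<open>complex^'a\<close> with \<open>'a\<close> finite;
  \<open>complex^'a^'b\<close> (rows indexed by \<open>'b\<close>) is the space of operators from \<open>complex^'a\<close> to
  \<open>complex^'b\<close>.  The inner product \<open>cinner\<close> is conjugate-linear in its first argument; the
  library's real-valued \<open>inner\<close> on \<open>complex^'a\<close> is only its real part.
\<close>

definition cinner :: "complex^'a \<Rightarrow> complex^'a \<Rightarrow> complex" where
  "cinner u w = (\<Sum>i\<in>UNIV. cnj (u $ i) * w $ i)"

definition dagger :: "complex^'a^'b \<Rightarrow> complex^'b^'a" where
  "dagger M = map_matrix cnj (transpose M)"

definition mat_scale :: "complex \<Rightarrow> complex^'a^'b \<Rightarrow> complex^'a^'b" where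
  "mat_scale c M = map_matrix ((*) c) M"

definition tensor_vec :: "complex^'a \<Rightarrow> complex^'b \<Rightarrow> complex^('a::finite \<times> 'b::finite)" where
  "tensor_vec u w = (\<chi> p. u $ fst p * w $ snd p)"

text \<open>The rank-one operator \<open>|u\<rangle>\<langle>u|\<close>.\<close>

definition ketbra :: "complex^'a \<Rightarrow> complex^'a^'a" where
  "ketbra u = (\<chi> i j. u $ i * cnj (u $ j))"

text \<open>
  For complete positivity the dimension \<open>k\<close> of the ancilla must range over all natural numbers,
  so it cannot be a type.  An operator on \<open>\<complex>\<^sup>k \<otimes> complex^'a\<close> is given here by its
  \<open>k \<times> k\<close> blocks \<open>X i j\<close> (\<open>i, j < k\<close>), a vector by its components \<open>v i\<close>, and the map
  \<open>id\<^sub>k \<otimes> \<Lambda>\<close> acts by applying \<open>\<Lambda>\<close> to every block.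
\<close>

definition psd_blocks :: "nat \<Rightarrow> (nat \<Rightarrow> nat \<Rightarrow> complex^'a^'a) \<Rightarrow> bool" where
  "psd_blocks k X \<longleftrightarrow>
     (\<forall>v :: nat \<Rightarrow> complex^'a. (\<Sum>i<k. \<Sum>j<k. cinner (v i) (X i j *v v j)) \<in> \<real>\<^sub>\<ge>\<^sub>0)"

definition completely_positive :: "(complex^'a^'a \<Rightarrow> complex^'b^'b) \<Rightarrow> bool" where
  "completely_positive \<Lambda> \<longleftrightarrow>
     (\<forall>k X. psd_blocks k X \<longrightarrow> psd_blocks k (\<lambda>i j. \<Lambda> (X i j)))"

definition channel :: "(complex^'a^'a \<Rightarrow> complex^'b^'b) \<Rightarrow> bool" where
  "channel \<Lambda> \<longleftrightarrow>
     (\<forall>X Y. \<Lambda> (X + Y) = \<Lambda> X + \<Lambda> Y) \<and>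
     (\<forall>c X. \<Lambda> (mat_scale c X) = mat_scale c (\<Lambda> X)) \<and>
     completely_positive \<Lambda> \<and>
     (\<forall>X. trace (\<Lambda> X) = trace X)"

text \<open>
  \<open>\<Lambda> \<otimes> \<I>\<^sub>R\<close> on operators over the product index type: for each pair \<open>(r, r')\<close> of
  reference indices, \<open>\<Lambda>\<close> is applied to the corresponding block.
\<close>

definition tensor_id ::
  "(complex^'a^'a \<Rightarrow> complex^'b^'b) \<Rightarrow> complex^('a \<times> 'r::finite)^('a \<times> 'r) \<Rightarrow> complex^('b \<times> 'r)^('b \<times> 'r)"
where
  "tensor_id \<Lambda> X =
     (\<chi> p q. \<Lambda> (\<chi> a a'. X $ (a, snd p) $ (a', snd q)) $ fst p $ fst q)"

definition max_entangled :: "complex^('l::finite \<times> 'l)" where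
  "max_entangled =
     (1 / complex_of_real (sqrt (real CARD('l)))) *s
       (\<Sum>k\<in>UNIV. tensor_vec (axis k 1) (axis k 1))"

text \<open>
  For a channel the expectation value below is a nonnegative real; \<open>Re\<close> only converts its type.
\<close>

definition entanglement_fidelity :: "(complex^'l^'l \<Rightarrow> complex^'l^'l) \<Rightarrow> real" where
  "entanglement_fidelity \<Lambda> =
     sqrt (Re (cinner max_entangled (tensor_id \<Lambda> (ketbra max_entangled) *v max_entangled)))"

text \<open>
  The maximum is taken literally (\<open>GREATEST\<close>, not a supremum): the definition is informative only
  once the maximum has been shown to be attained.
\<close>

definition recovery_fidelity :: "(complex^'l^'l \<Rightarrow> complex^'s^'s) \<Rightarrow> real" where
  "recovery_fidelity \<Lambda> =
     (GREATEST f. \<exists>\<R> :: complex^'s^'s \<Rightarrow> complex^'l^'l.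
        channel \<R> \<and> f = entanglement_fidelity (\<R> \<circ> \<Lambda>))"

text \<open>
  The infidelity is a function of the Kraus operators, not of the channels alone.  The first sum of
  traces is real, so \<open>Re\<close> again only converts its type.
\<close>

definition infidelity ::
  "nat \<Rightarrow> (nat \<Rightarrow> complex^'l^'s) \<Rightarrow> nat \<Rightarrow> (nat \<Rightarrow> complex^'s^'s) \<Rightarrow> real"
where
  "infidelity m E n A =
     (let d = real CARD('l);
          Q = (\<Sum>s = 1..m. E s ** dagger (E s))
      in sqrt (real m * real n / (4 * d)) *
         sqrt (Re (\<Sum>i = 1..n. \<Sum>j = 1..n.
                     trace (dagger (A i) ** A j ** Q ** dagger (A j) ** A i ** Q))
               - 1 / d * (\<Sum>i = 1..n. \<Sum>j = 1..n. \<Sum>s = 1..m. \<Sum>t = 1..m.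
                     (cmod (trace (dagger (A i) ** A j ** E t ** dagger (E s))))\<^sup>2)))"

end

theory Submission
  imports Defs
begin

text \<open>
  Write \<open>K\<^sub>a\<close> for the \<open>mn\<close> operators \<open>A\<^sub>i E\<^sub>s\<close> and let
  \<open>G = (K\<^sub>a\<^sup>\<dagger> K\<^sub>b)\<^sub>a\<^sub>b\<close> and \<open>S = (tr K\<^sub>a\<^sup>\<dagger> K\<^sub>b)\<^sub>a\<^sub>b\<close>; up to normalisation these are the states of
  reference and environment and of the environment alone.  With \<open>P = \<surd>G\<close> and
  \<open>B = \<surd>(S \<otimes> 1/d)\<close>, the polar decomposition of the row \<open>(K\<^sub>a)\<^sub>a\<close> yields a recovery channel whose
  entanglement fidelity is at least \<open>tr(P B)/d = 1 - tr((P - B)\<^sup>2)/(2d)\<close>.  By Cauchy--Schwarz on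
  a space of dimension \<open>mnd\<close>, \<open>tr((P - B)\<^sup>2) \<le> \<surd>(mnd) \<surd>(tr((P - B)\<^sup>4))\<close>, and
  \<open>tr((P - B)\<^sup>4) \<le> tr((P\<^sup>2 - B\<^sup>2)\<^sup>2)\<close>, a Hilbert--Schmidt form of the Powers--Stormer
  inequality.  The right-hand side is the expression under the root in the infidelity.

  Since \<open>mn\<close> is a number and not a type, the \<open>K\<^sub>a\<close> are first replaced by an equivalent Kraus family indexed
  by \<open>'s \<times> 'l\<close> with at most \<open>mn\<close> nonzero members.
\<close>

section \<open>Entrywise calculus of adjoints, products, traces and the inner product\<close>

lemma dagger_nth [simp]: "dagger M $ i $ j = cnj (M $ j $ i)"
  by (simp add: dagger_def transpose_def)

lemma mat_scale_nth [simp]: "mat_scale c M $ i $ j = c * M $ i $ j"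
  by (simp add: mat_scale_def)

lemma ketbra_nth [simp]: "ketbra u $ i $ j = u $ i * cnj (u $ j)"
  by (simp add: ketbra_def)

lemma matrix_mult_nth: "(M ** N) $ i $ j = (\<Sum>k\<in>UNIV. M $ i $ k * N $ k $ j)"
  by (simp add: matrix_matrix_mult_def)

lemma matrix_vector_mult_nth: "(M *v x) $ i = (\<Sum>k\<in>UNIV. M $ i $ k * x $ k)"
  by (simp add: matrix_vector_mult_def)

lemma dagger_dagger [simp]: "dagger (dagger M) = M"
  by (simp add: vec_eq_iff)

lemma dagger_mult: "dagger (M ** N) = dagger N ** dagger M"
  by (simp add: vec_eq_iff matrix_mult_nth mult.commute)

lemma dagger_diff: "dagger (M - N) = dagger M - dagger N"
  by (simp add: vec_eq_iff)

lemma dagger_mat_1 [simp]: "dagger (mat 1) = mat 1"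
  by (simp add: vec_eq_iff mat_def)

lemma matrix_diff_ldistrib: "(A ** (B - C)) = (A ** B) - (A ** C)"
  for A :: "complex^'b^'a"
  by (simp add: vec_eq_iff matrix_mult_nth right_diff_distrib sum_subtractf)

lemma matrix_diff_rdistrib: "((A - B) ** C) = (A ** C) - (B ** C)"
  for A :: "complex^'b^'a"
  by (simp add: vec_eq_iff matrix_mult_nth left_diff_distrib sum_subtractf)

lemma matrix_add_rdistrib: "((A + B) ** C) = (A ** C) + (B ** C)"
  for A :: "complex^'b^'a"
  by (simp add: vec_eq_iff matrix_mult_nth distrib_right sum.distrib)

lemma matrix_mult_sum_left: "sum f I ** M = (\<Sum>i\<in>I. f i ** M)"
  for M :: "complex^'b^'a"
  by (induction I rule: infinite_finite_induct) (simp_all add: matrix_add_rdistrib)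

lemma matrix_mult_sum_right: "M ** sum f I = (\<Sum>i\<in>I. M ** f i)"
  for M :: "complex^'b^'a"
  by (induction I rule: infinite_finite_induct) (simp_all add: matrix_add_ldistrib)

lemma trace_sum: "trace (sum f I) = (\<Sum>i\<in>I. trace (f i))"
  for f :: "'i \<Rightarrow> complex^'n^'n"
  by (induction I rule: infinite_finite_induct) (simp_all add: trace_add trace_0[unfolded mat_0] )

lemma trace_dagger: "trace (dagger M) = cnj (trace M)"
  by (simp add: trace_def)

lemma trace_mat_scale: "trace (mat_scale c M) = c * trace M"
  by (simp add: trace_def sum_distrib_left)

lemma mat_scale_mult_left: "mat_scale c M ** N = mat_scale c (M ** N)"
  by (simp add: vec_eq_iff matrix_mult_nth sum_distrib_left mult.assoc)

lemma mat_scale_mult_right: "M ** mat_scale c N = mat_scale c (M ** N)"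
  by (simp add: vec_eq_iff matrix_mult_nth sum_distrib_left mult.left_commute)

lemma ketbra_mult_ketbra: "ketbra v ** ketbra v = mat_scale (cinner v v) (ketbra v)"
  by (simp add: vec_eq_iff matrix_mult_nth cinner_def sum_distrib_left sum_distrib_right mult_ac)

lemma cinner_dagger: "cinner u (M *v w) = cinner (dagger M *v u) w"
  by (simp add: cinner_def matrix_vector_mult_nth sum_distrib_left sum_distrib_right mult_ac)
     (subst sum.swap, simp)

lemma trace_ketbra_mult: "trace (ketbra v ** M) = cinner v (M *v v)"
  by (simp add: trace_def matrix_mult_nth cinner_def matrix_vector_mult_nth sum_distrib_left mult_ac)
     (subst sum.swap, simp)

lemma mult_cnj_cmod: "z * cnj z = (of_real (cmod z))\<^sup>2" "cnj z * z = (of_real (cmod z))\<^sup>2"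
  by (simp_all add: complex_norm_square[symmetric] mult.commute[of "cnj z"] flip: of_real_power)

lemma cinner_self: "cinner v v = of_real (\<Sum>i\<in>UNIV. (cmod (v $ i))\<^sup>2)"
  by (simp add: cinner_def mult_cnj_cmod)

lemma cinner_self_eq_0_iff: "cinner v v = 0 \<longleftrightarrow> v = 0"
  unfolding cinner_self of_real_eq_0_iff by (subst sum_nonneg_eq_0_iff) (auto simp: vec_eq_iff)

lemma cinner_self_nonneg: "cinner v v \<in> \<real>\<^sub>\<ge>\<^sub>0"
  unfolding cinner_self nonneg_Reals_of_real_iff by (simp add: sum_nonneg)

lemma trace_dagger_mult_self: "trace (dagger M ** M) = of_real (\<Sum>i\<in>UNIV. \<Sum>j\<in>UNIV. (cmod (M $ i $ j))\<^sup>2)"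
  by (simp add: trace_def matrix_mult_nth mult_cnj_cmod) (rule sum.swap)

section \<open>Positive semidefinite matrices\<close>

definition psd :: "complex^'n^'n \<Rightarrow> bool" where
  "psd M \<longleftrightarrow> (\<forall>v. cinner v (M *v v) \<in> \<real>\<^sub>\<ge>\<^sub>0)"

lemma psdD: "psd M \<Longrightarrow> cinner v (M *v v) \<in> \<real>\<^sub>\<ge>\<^sub>0"
  by (simp add: psd_def)

lemma cinner_two_axes:
  assumes "i \<noteq> j"
  shows "cinner (axis i a + axis j b) (M *v (axis i a + axis j b)) =
    cnj a * a * M $ i $ i + cnj a * b * M $ i $ j + cnj b * a * M $ j $ i + cnj b * b * M $ j $ j"
proof -
  have 1: "(M *v (axis i a + axis j b)) $ k = a * M $ k $ i + b * M $ k $ j" for k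
    using assms by (simp add: matrix_vector_mult_nth axis_def distrib_left sum.distrib
        if_distrib[of "\<lambda>x. _ * x"] cong: if_cong)
  have "cinner (axis i a + axis j b) w = cnj a * w $ i + cnj b * w $ j" for w
    using assms by (simp add: cinner_def axis_def distrib_right sum.distrib
        if_distrib[of "\<lambda>x. x * _"] if_distrib[of cnj] cong: if_cong)
  then show ?thesis by (simp only: 1) (simp add: distrib_left mult_ac)
qed

lemma cinner_axis: "cinner (axis i a) (M *v axis i a) = cnj a * a * M $ i $ i"
  by (simp add: cinner_def matrix_vector_mult_nth axis_def if_distrib[of "\<lambda>x. x * _"]
      if_distrib[of "\<lambda>x. _ * x"] if_distrib[of cnj] cong: if_cong)

lemma psd_diag: "psd M \<Longrightarrow> M $ i $ i \<in> \<real>\<^sub>\<ge>\<^sub>0"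
  using psdD[of M "axis i 1"] by (simp add: cinner_axis)

text \<open>Polarisation: the form is real at \<open>e_i + e_j\<close> and at
  \<open>e_i + \<i> e_j\<close>. The first makes the imaginary part of \<open>M_ij + M_ji\<close>
  vanish, the second the real part of \<open>M_ij - M_ji\<close>.\<close>

lemma psd_hermitian:
  assumes "psd M"
  shows "dagger M = M"
proof -
  have "cnj (M $ j $ i) = M $ i $ j" for i j
  proof (cases "i = j")
    case True
    then show ?thesis using psd_diag[OF assms, of i]
      by (simp add: complex_nonneg_Reals_iff complex_eq_iff)
  next
    case False
    then show ?thesis
      using psdD[OF assms, of "axis i 1 + axis j 1"] psdD[OF assms, of "axis i 1 + axis j \<i>"]
        psd_diag[OF assms, of i] psd_diag[OF assms, of j]
      by (simp add: cinner_two_axes complex_nonneg_Reals_iff complex_eq_iff)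
  qed
  then show ?thesis by (simp add: vec_eq_iff)
qed

text \<open>With a zero diagonal entry the form at \<open>- r M_ij e_i + e_j\<close> is affine in
  \<open>r\<close> with slope \<open>- 2 |M_ij|^2\<close>, so it would become negative for large
  \<open>r\<close> unless \<open>M_ij\<close> vanishes.\<close>

lemma psd_row_zero:
  assumes "psd M" "M $ i $ i = 0"
  shows "M $ i $ j = 0"
proof (cases "i = j")
  case False
  have h: "M $ j $ i = cnj (M $ i $ j)"
    using psd_hermitian[OF assms(1)] by (metis dagger_nth)
  let ?c = "(cmod (M $ i $ j))\<^sup>2"
  have *: "2 * r * ?c \<le> Re (M $ j $ j)" for r :: real
  proof -
    have "cinner (axis i (- of_real r * M $ i $ j) + axis j 1) (M *v (axis i (- of_real r * M $ i $ j) + axis j 1))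
       = M $ j $ j - of_real (2 * r * ?c)"
      using False assms(2) by (subst cinner_two_axes) (simp_all add: h mult_cnj_cmod mult.assoc)
    then show ?thesis
      using psdD[OF assms(1), of "axis i (- of_real r * M $ i $ j) + axis j 1"]
      by (simp add: complex_nonneg_Reals_iff)
  qed
  show ?thesis
  proof (rule ccontr)
    assume "M $ i $ j \<noteq> 0"
    then have "?c > 0" by simp
    then show False
      \<comment> \<open>This \<open>r\<close> turns the bound into
        \<open>2 (Re M_jj + 1) \<le> Re M_jj\<close>, while \<open>r = 0\<close> gives
        \<open>0 \<le> Re M_jj\<close>.\<close>
      using *[of "(Re (M $ j $ j) + 1) / ?c"] *[of 0] by simp
  qed
qed (use assms in simp)

section \<open>Polar decomposition\<close>

text \<open>The columns of \<open>U\<close> are unit vectors, so all entries have modulus at most 1,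
  and the defining equations are continuous in \<open>U\<close>. Compactness provides the maximiser
  in \<open>unitary_psd\<close>.\<close>

lemma compact_unitary: "compact {U :: complex^'n^'n. dagger U ** U = mat 1}"
proof -
  have "closed {U :: complex^'n^'n. dagger U ** U = mat 1}"
    unfolding vec_eq_iff matrix_mult_nth dagger_nth Collect_all_eq
    by (intro closed_INT ballI closed_Collect_eq continuous_intros)
  moreover have "bounded {U :: complex^'n^'n. dagger U ** U = mat 1}"
  proof (rule boundedI)
    fix U :: "complex^'n^'n" assume "U \<in> {U. dagger U ** U = mat 1}"
    then have U: "dagger U ** U = mat 1" by simp
    have 1: "cmod (U $ i $ j) \<le> 1" for i j
    proof -
      have "of_real (\<Sum>k\<in>UNIV. (cmod (U $ k $ j))\<^sup>2) = (dagger U ** U) $ j $ j"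
        by (simp add: matrix_mult_nth mult_cnj_cmod)
      then have "complex_of_real (\<Sum>k\<in>UNIV. (cmod (U $ k $ j))\<^sup>2) = 1"
        unfolding U by (simp only: mat_def vec_lambda_beta simp_thms if_True)
      then have "(\<Sum>k\<in>UNIV. (cmod (U $ k $ j))\<^sup>2) = 1"
        by (simp only: of_real_eq_1_iff)
      then have "(cmod (U $ i $ j))\<^sup>2 \<le> 1\<^sup>2"
        using member_le_sum[of i UNIV "\<lambda>k. (cmod (U $ k $ j))\<^sup>2"] by simp
      then show ?thesis by (rule power2_le_imp_le) simp
    qed
    have "norm U \<le> (\<Sum>i\<in>UNIV. norm (U $ i))"
      by (simp add: norm_vec_def L2_set_le_sum)
    also have "\<dots> \<le> (\<Sum>i\<in>UNIV. \<Sum>j\<in>UNIV. cmod (U $ i $ j))"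
      by (intro sum_mono) (simp add: norm_vec_def L2_set_le_sum)
    also have "\<dots> \<le> (\<Sum>i\<in>(UNIV :: 'n set). \<Sum>j\<in>(UNIV :: 'n set). 1)" by (intro sum_mono 1)
    finally show "norm U \<le> (\<Sum>i\<in>(UNIV :: 'n set). \<Sum>j\<in>(UNIV :: 'n set). 1)" .
  qed
  ultimately show ?thesis by (simp add: compact_eq_bounded_closed)
qed

text \<open>\<open>V\<close> multiplies \<open>v\<close> by the phase \<open>w\<close> and fixes the
  orthogonal complement of \<open>v\<close>.\<close>

lemma unitary_phase:
  assumes "cmod w = 1" "v \<noteq> 0"
  defines "V \<equiv> mat 1 + mat_scale ((w - 1) / cinner v v) (ketbra v)"
  shows "dagger V ** V = mat 1"
proof -
  define N where "N = cinner v v"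
  have N: "N \<noteq> 0" "cnj N = N" using assms(2) cinner_self_eq_0_iff[of v]
    by (auto simp: N_def cinner_self)
  define c where "c = (w - 1) / N"
  have w: "w * cnj w = 1" using assms(1) by (simp add: complex_norm_square[symmetric])
  \<comment> \<open>Since \<open>1 + c N = w\<close>, this is \<open>|1 + c N|^2 = 1\<close> with 1
    subtracted and divided by \<open>N\<close>.\<close>
  have "cnj c + c + cnj c * c * N = 0"
    using N w by (simp add: c_def field_simps)
  then have *: "cnj c * z + c * z + cnj c * c * N * z = 0" for z
    by (metis (no_types) distrib_right mult_zero_left)
  have "dagger V = mat 1 + mat_scale (cnj c) (ketbra v)"
    by (simp add: V_def c_def N_def vec_eq_iff mat_def mult_ac)
  then have "dagger V ** V = (mat 1 + mat_scale (cnj c) (ketbra v)) ** (mat 1 + mat_scale c (ketbra v))"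
    by (simp add: V_def c_def N_def)
  also have "\<dots> = mat 1 + (mat_scale (cnj c) (ketbra v) + mat_scale c (ketbra v) +
       mat_scale (cnj c * c * N) (ketbra v))"
    by (simp add: matrix_add_ldistrib matrix_add_rdistrib mat_scale_mult_left mat_scale_mult_right
        ketbra_mult_ketbra N_def vec_eq_iff algebra_simps)
  also have "mat_scale (cnj c) (ketbra v) + mat_scale c (ketbra v) + mat_scale (cnj c * c * N) (ketbra v) = 0"
    using * by (simp add: vec_eq_iff)
  finally show ?thesis by simp
qed

text \<open>A unitary \<open>U\<close> maximising \<open>Re tr(UX)\<close> cannot be improved by a phase change
  along any vector \<open>v\<close>, which forces \<open>\<langle>v|UX|v\<rangle>\<close> to be nonnegative.\<close>

lemma unitary_psd:
  fixes X :: "complex^'n^'n"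
  obtains U where "dagger U ** U = mat 1" "psd (U ** X)"
proof -
  let ?S = "{U :: complex^'n^'n. dagger U ** U = mat 1}"
  have "continuous_on ?S (\<lambda>U. Re (trace (U ** X)))"
    unfolding trace_def matrix_mult_nth by (intro continuous_intros)
  moreover have "mat 1 \<in> ?S" by simp
  ultimately obtain U where U: "U \<in> ?S"
    and max: "\<And>V. V \<in> ?S \<Longrightarrow> Re (trace (V ** X)) \<le> Re (trace (U ** X))"
    using continuous_attains_sup[OF compact_unitary] by (smt (verit) empty_iff)
  have "cinner v ((U ** X) *v v) \<in> \<real>\<^sub>\<ge>\<^sub>0" for v
  proof (cases "v = 0 \<or> cinner v ((U ** X) *v v) = 0")
    case True
    then show ?thesis by (auto simp: cinner_def)
  next
    case False
    define z where "z = cinner v ((U ** X) *v v)"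
    \<comment> \<open>The phase for which \<open>w * z = |z|\<close>; \<open>V\<close> applies it
      along \<open>v\<close>, so that \<open>V ** U\<close> competes with the maximiser
      \<open>U\<close>.\<close>
    define w where "w = cnj z / cmod z"
    define V where "V = mat 1 + mat_scale ((w - 1) / cinner v v) (ketbra v)"
    have z: "z \<noteq> 0" and v: "v \<noteq> 0" using False by (auto simp: z_def)
    have "cmod w = 1" using z by (simp add: w_def norm_divide)
    then have "dagger V ** V = mat 1" using unitary_phase v V_def by blast
    then have "dagger (V ** U) ** (V ** U) = mat 1" using U
      by (simp add: dagger_mult) (metis matrix_mul_assoc matrix_mul_rid)
    then have "Re (trace ((V ** U) ** X)) \<le> Re (trace (U ** X))" using max by blast
    moreover have "(V ** U) ** X = U ** X + mat_scale ((w - 1) / cinner v v) (ketbra v ** (U ** X))"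
      by (simp add: V_def matrix_add_rdistrib mat_scale_mult_left matrix_mul_assoc)
    ultimately have "Re ((w - 1) / cinner v v * z) \<le> 0"
      by (simp add: trace_add trace_mat_scale trace_ketbra_mult z_def)
    moreover define s where "s = (\<Sum>i\<in>UNIV. (cmod (v $ i))\<^sup>2)"
    have "cinner v v = of_real s" by (simp add: s_def cinner_self)
    moreover have "s > 0" using v \<open>cinner v v = of_real s\<close> cinner_self_eq_0_iff[of v]
      by (metis cinner_self_nonneg nonneg_Reals_of_real_iff of_real_0 order_le_less)
    moreover have "Re ((w - 1) / of_real s * z) = Re ((w - 1) * z) / s" by simp
    ultimately have "Re ((w - 1) * z) \<le> 0" by (metis divide_le_0_iff not_less)
    moreover have "w * z = of_real (cmod z)" using z
      by (simp add: w_def mult_cnj_cmod power2_eq_square)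
    \<comment> \<open>Only a nonnegative real number satisfies this.\<close>
    ultimately have "cmod z \<le> Re z" by (simp add: left_diff_distrib)
    then have "Re z = cmod z" using complex_Re_le_cmod[of z] by simp
    then have "Re z \<ge> 0" "Im z = 0" using cmod_eq_Re[of z] cmod_power2[of z] by auto
    then show ?thesis by (simp add: z_def complex_nonneg_Reals_iff)
  qed
  then show ?thesis using that U by (simp add: psd_def)
qed

lemma sum_UNIV_Plus: "(\<Sum>x\<in>UNIV. f x) = (\<Sum>a\<in>UNIV. f (Inl a)) + (\<Sum>b\<in>UNIV. f (Inr b))"
  for f :: "'a::finite + 'b::finite \<Rightarrow> 'c::comm_monoid_add"
  using sum.Plus[of "UNIV :: 'a set" "UNIV :: 'b set" f] by simp

text \<open>Obtained from the unitary case by padding \<open>C\<close> with zeros to a square matrix;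
  \<open>V\<close> is the corner of the unitary that completes \<open>W\<close> to an isometry.\<close>

lemma polar_decomposition:
  fixes C :: "complex^'a^'b"
  obtains P :: "complex^'a^'a" and W :: "complex^'b^'a" and V :: "complex^'b^'b"
  where "psd P" "P = W ** C" "P ** P = dagger C ** C" "dagger W ** W + dagger V ** V = mat 1"
proof -
  \<comment> \<open>Only the block of \<open>X\<close> from \<open>'a\<close> to \<open>'b\<close>
    is nonzero, so only the columns of \<open>U\<close> indexed by \<open>'b\<close> enter
    \<open>U ** X\<close>.\<close>
  define X :: "complex^('a + 'b)^('a + 'b)" where
    "X = (\<chi> x y. case (x, y) of (Inr b, Inl a) \<Rightarrow> C $ b $ a | _ \<Rightarrow> 0)"
  have X: "X $ Inr b $ Inl a = C $ b $ a" "X $ x $ Inr b = 0" "X $ Inl a $ y = 0" for a b x y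
    by (simp_all add: X_def split: sum.splits)
  obtain U where U: "dagger U ** U = mat 1" and Q: "psd (U ** X)"
    using unitary_psd by blast
  have QQ: "(U ** X) ** (U ** X) = dagger X ** X"
  proof -
    have "(U ** X) ** (U ** X) = dagger (U ** X) ** (U ** X)" using psd_hermitian[OF Q] by simp
    also have "\<dots> = dagger X ** ((dagger U ** U) ** X)" by (simp add: dagger_mult matrix_mul_assoc)
    finally show ?thesis by (simp add: U)
  qed
  define W :: "complex^'b^'a" where "W = (\<chi> a b. U $ Inl a $ Inr b)"
  define V :: "complex^'b^'b" where "V = (\<chi> c b. U $ Inr c $ Inr b)"
  define P where "P = W ** C"
  have P: "P $ a $ a' = (U ** X) $ Inl a $ Inl a'" for a a'
    by (simp add: P_def matrix_mult_nth W_def sum_UNIV_Plus X)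
  have "psd P"
    unfolding psd_def
  proof
    fix v :: "complex^'a"
    define v' :: "complex^('a + 'b)" where "v' = (\<chi> x. case x of Inl a \<Rightarrow> v $ a | Inr b \<Rightarrow> 0)"
    have "cinner v (P *v v) = cinner v' ((U ** X) *v v')"
      by (simp add: cinner_def matrix_vector_mult_nth v'_def sum_UNIV_Plus P)
    then show "cinner v (P *v v) \<in> \<real>\<^sub>\<ge>\<^sub>0" using psdD[OF Q] by simp
  qed
  moreover have "P ** P = dagger C ** C"
  proof -
    have "(P ** P) $ a $ a' = (dagger C ** C) $ a $ a'" for a a'
    proof -
      \<comment> \<open>The columns of \<open>X\<close> indexed by \<open>'b\<close> vanish, so the
        corner of the square of \<open>U ** X\<close> is the square of its corner
        \<open>P\<close>.\<close>
      have "(U ** X) $ Inl a $ Inr b = 0" for b by (simp add: matrix_mult_nth X)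
      then have "(P ** P) $ a $ a' = ((U ** X) ** (U ** X)) $ Inl a $ Inl a'"
        by (simp add: P sum_UNIV_Plus matrix_mult_nth[of P] matrix_mult_nth[of "U ** X"])
      also have "\<dots> = (dagger C ** C) $ a $ a'"
        unfolding QQ by (simp add: matrix_mult_nth sum_UNIV_Plus X)
      finally show ?thesis .
    qed
    then show ?thesis by (simp add: vec_eq_iff)
  qed
  moreover have "dagger W ** W + dagger V ** V = mat 1"
  proof -
    have "(dagger W ** W + dagger V ** V) $ b $ b' = (dagger U ** U) $ Inr b $ Inr b'" for b b'
      by (simp add: matrix_mult_nth sum_UNIV_Plus W_def V_def)
    then show ?thesis by (simp add: U vec_eq_iff mat_def)
  qed
  ultimately show ?thesis using that P_def by blast
qed

section \<open>Positive semidefinite matrices as sums of rank-one operators\<close>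

lemma cinner_ketbra: "cinner v (ketbra c *v v) = of_real ((cmod (cinner c v))\<^sup>2)"
proof -
  have "ketbra c *v v = cinner c v *s c"
    by (simp add: vec_eq_iff matrix_vector_mult_nth cinner_def sum_distrib_left sum_distrib_right mult_ac)
  moreover have "cinner v (z *s c) = z * cnj (cinner c v)" for z
    by (simp add: cinner_def sum_distrib_left mult_ac)
  ultimately show ?thesis by (simp add: mult_cnj_cmod)
qed

lemma psd_ketbra: "psd (ketbra c)"
  by (simp add: psd_def cinner_ketbra)

lemma psd_sum: "(\<And>i. i \<in> I \<Longrightarrow> psd (f i)) \<Longrightarrow> psd (sum f I)"
proof (induction I rule: infinite_finite_induct)
  case (insert i I)
  then show ?case
    by (simp add: psd_def matrix_vector_mult_add_rdistrib cinner_def distrib_left sum.distrib)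
qed (simp_all add: psd_def cinner_def)

text \<open>One step of Gaussian elimination: the Schur complement is the form \<open>\<langle>w|M|w\<rangle>\<close>
  at \<open>w = v - (\<langle>i|M|v\<rangle> / M\<^sub>i\<^sub>i) |i\<rangle>\<close>.\<close>

lemma psd_schur_complement:
  fixes M :: "complex^'n^'n"
  assumes "psd M" "M $ i $ i \<noteq> 0"
  defines "c \<equiv> (\<chi> a. M $ a $ i / complex_of_real (sqrt (Re (M $ i $ i))))"
  shows "psd (M - ketbra c)" "(M - ketbra c) $ a $ b = M $ a $ b - M $ a $ i * M $ i $ b / M $ i $ i"
proof -
  define r where "r = Re (M $ i $ i)"
  have mr: "M $ i $ i = of_real r" and r: "r > 0"
    using psd_diag[OF assms(1), of i] assms(2)
    by (auto simp: r_def complex_nonneg_Reals_iff complex_eq_iff)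
  have sq: "complex_of_real (sqrt r) * complex_of_real (sqrt r) = of_real r"
    using r by (simp flip: of_real_mult)
  have h: "cnj (M $ a $ b) = M $ b $ a" for a b
    using psd_hermitian[OF assms(1)] by (metis dagger_nth)
  have entry: "(M - ketbra c) $ a $ b = M $ a $ b - M $ a $ i * M $ i $ b / M $ i $ i" for a b
    by (simp add: c_def h mr sq flip: r_def)
  then show "(M - ketbra c) $ a $ b = M $ a $ b - M $ a $ i * M $ i $ b / M $ i $ i" .
  show "psd (M - ketbra c)"
    unfolding psd_def
  proof
    fix v :: "complex^'n"
    define t where "t = (M *v v) $ i"
    define w where "w = v - axis i (t / of_real r)"
    have ax: "(M *v axis i z) $ a = M $ a $ i * z" for a z
      by (simp add: matrix_vector_mult_nth axis_def if_distrib[of "\<lambda>x. _ * x"] cong: if_cong)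
    have cax: "cinner (axis i z) u = cnj z * u $ i" for z u
      by (simp add: cinner_def axis_def if_distrib[of "\<lambda>x. x * _"] if_distrib[of cnj] cong: if_cong)
    have ct': "cnj t = (\<Sum>a\<in>UNIV. cnj (v $ a) * M $ a $ i)"
      by (simp add: t_def matrix_vector_mult_nth h mult.commute)
    have ct: "cinner v (M *v axis i z) = cnj t * z" for z
      by (simp add: cinner_def ax ct' sum_distrib_right mult.assoc)
    have dl: "cinner (x - y) u = cinner x u - cinner y u" for x y u
      by (simp add: cinner_def left_diff_distrib sum_subtractf)
    have dr: "cinner u (x - y) = cinner u x - cinner u y" for x y u
      by (simp add: cinner_def right_diff_distrib sum_subtractf)
    have "cinner w (M *v w) = cinner v (M *v v) - cnj t * t / of_real r"
      using r by (simp add: w_def matrix_vector_mult_diff_distrib dl dr ct cax ax mr t_def[symmetric])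
    moreover have "cinner c v = t / complex_of_real (sqrt r)"
      by (simp add: cinner_def c_def t_def matrix_vector_mult_nth h sum_divide_distrib flip: r_def)
    then have "cinner v (ketbra c *v v) = cnj t * t / of_real r"
      using r by (simp add: cinner_ketbra norm_divide power_divide mult_cnj_cmod)
    then have "cinner v ((M - ketbra c) *v v) = cinner v (M *v v) - cnj t * t / of_real r"
      by (simp add: matrix_vector_mult_diff_rdistrib dr)
    ultimately show "cinner v ((M - ketbra c) *v v) \<in> \<real>\<^sub>\<ge>\<^sub>0"
      using psdD[OF assms(1), of w] by simp
  qed
qed

text \<open>Cholesky elimination along the support \<open>S\<close>: a nonzero pivot splits off one
  rank-one term, and the Schur complement vanishes in row \<open>i\<close>; a zero pivot makes the
  whole row vanish, and \<open>i\<close> gets the zero vector.\<close>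

lemma psd_ketbra_decomposition_on:
  fixes M :: "complex^'n^'n"
  assumes "finite S" "psd M" "\<And>i j. i \<notin> S \<Longrightarrow> M $ i $ j = 0"
  shows "\<exists>v. M = (\<Sum>c\<in>S. ketbra (v c))"
  using assms
proof (induction S arbitrary: M rule: finite_induct)
  case empty
  then show ?case by (simp add: vec_eq_iff)
next
  case (insert i S)
  show ?case
  proof (cases "M $ i $ i = 0")
    case True
    then have "M $ a $ b = 0" if "a \<notin> S" for a b
      using that insert.prems psd_row_zero by (cases "a = i") auto
    then obtain v where v: "M = (\<Sum>c\<in>S. ketbra (v c))" using insert by meson
    have "ketbra 0 = (0 :: complex^'n^'n)" by (simp add: vec_eq_iff)
    moreover have "(\<Sum>c\<in>S. ketbra ((v(i := 0)) c)) = (\<Sum>c\<in>S. ketbra (v c))"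
      using insert.hyps by (intro sum.cong) auto
    ultimately have "M = (\<Sum>c\<in>insert i S. ketbra ((v(i := 0)) c))"
      using insert.hyps v by simp
    then show ?thesis by blast
  next
    case False
    define c where "c = (\<chi> a. M $ a $ i / complex_of_real (sqrt (Re (M $ i $ i))))"
    note schur = psd_schur_complement[OF insert.prems(1) False, folded c_def]
    have "(M - ketbra c) $ a $ b = 0" if "a \<notin> S" for a b
      using that insert.prems(2) False unfolding schur(2) by (cases "a = i") auto
    then obtain v where v: "M - ketbra c = (\<Sum>d\<in>S. ketbra (v d))" using insert schur(1) by meson
    moreover have "(\<Sum>d\<in>S. ketbra ((v(i := c)) d)) = (\<Sum>d\<in>S. ketbra (v d))"
      using insert.hyps by (intro sum.cong) auto
    ultimately have "M = (\<Sum>d\<in>insert i S. ketbra ((v(i := c)) d))"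
      using insert.hyps by (simp add: algebra_simps)
    then show ?thesis by blast
  qed
qed

lemma psd_ketbra_decomposition:
  fixes M :: "complex^'n^'n"
  assumes "psd M"
  obtains v :: "'n \<Rightarrow> complex^'n" where "M = (\<Sum>c\<in>UNIV. ketbra (v c))"
  using psd_ketbra_decomposition_on[of UNIV M] assms by auto

text \<open>Replaces the index set of a sum of rank-one operators by a type without adding nonzero
  terms. If \<open>I\<close> is no larger than the dimension, it embeds in \<open>'n\<close> and the
  remaining indices get the zero vector; otherwise a Cholesky decomposition, with at most
  \<open>CARD('n)\<close> terms, is short enough.\<close>

lemma ketbra_sum_reindex:
  fixes u :: "'i \<Rightarrow> complex^'n"
  assumes "finite I"
  obtains v :: "'n \<Rightarrow> complex^'n" where
    "(\<Sum>c\<in>UNIV. ketbra (v c)) = (\<Sum>a\<in>I. ketbra (u a))" "card {c. v c \<noteq> 0} \<le> card I"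
proof (cases "card I \<le> CARD('n)")
  case True
  then obtain g :: "'i \<Rightarrow> 'n" where g: "inj_on g I"
    using card_le_inj[OF assms, of "UNIV :: 'n set"] by auto
  define v where "v c = (if c \<in> g ` I then u (the_inv_into I g c) else 0)" for c
  have "(\<Sum>c\<in>UNIV. ketbra (v c)) = (\<Sum>c\<in>g ` I. ketbra (v c))"
    by (intro sum.mono_neutral_right) (auto simp: v_def vec_eq_iff)
  also have "\<dots> = (\<Sum>a\<in>I. ketbra (u a))"
    using g by (simp add: sum.reindex v_def the_inv_into_f_f)
  finally have eq: "(\<Sum>c\<in>UNIV. ketbra (v c)) = (\<Sum>a\<in>I. ketbra (u a))" .
  have "card {c. v c \<noteq> 0} \<le> card (g ` I)"
    using assms by (intro card_mono) (auto simp: v_def split: if_splits)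
  also have "\<dots> \<le> card I" by (rule card_image_le[OF assms])
  finally show ?thesis by (rule that[OF eq])
next
  case False
  have "psd (\<Sum>a\<in>I. ketbra (u a))" by (intro psd_sum psd_ketbra)
  then obtain v :: "'n \<Rightarrow> complex^'n" where v: "(\<Sum>a\<in>I. ketbra (u a)) = (\<Sum>c\<in>UNIV. ketbra (v c))"
    by (rule psd_ketbra_decomposition)
  have "card {c. v c \<noteq> 0} \<le> CARD('n)" by (intro card_mono) auto
  also have "\<dots> \<le> card I" using False by simp
  finally show ?thesis by (rule that[OF v[symmetric]])
qed

section \<open>A trace inequality for the difference of two positive matrices\<close>

text \<open>Splitting \<open>A\<close> into rank-one terms \<open>ketbra (v c)\<close> makes the
  trace a sum of values of the form of \<open>B\<close> at the vectors
  \<open>D *v v c\<close>.\<close>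

lemma trace_psd_conj_nonneg:
  fixes A B D :: "complex^'n^'n"
  assumes "psd A" "psd B" "dagger D = D"
  shows "0 \<le> Re (trace (A ** (D ** (B ** D))))"
proof -
  obtain v :: "'n \<Rightarrow> complex^'n" where v: "A = (\<Sum>c\<in>UNIV. ketbra (v c))"
    using psd_ketbra_decomposition[OF assms(1)] by blast
  have "trace (A ** (D ** (B ** D))) = (\<Sum>c\<in>UNIV. cinner (D *v v c) (B *v (D *v v c)))"
    unfolding v matrix_mult_sum_left trace_sum trace_ketbra_mult
    by (simp add: cinner_dagger[of _ D] assms(3) flip: matrix_vector_mul_assoc)
  then show ?thesis
    using psdD[OF assms(2)] by (simp add: complex_nonneg_Reals_iff sum_nonneg)
qed

text \<open>The difference of the two sides is
  \<open>4 tr (P (P - B) B (P - B)) + tr ([P, B]\<^sup>\<dagger> [P, B])\<close>.\<close>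

lemma trace_diff_pow4_le:
  fixes P B :: "complex^'n^'n"
  assumes "psd P" "psd B"
  defines "D \<equiv> P - B"
  shows "Re (trace ((D ** D) ** (D ** D))) \<le> Re (trace ((P ** P - B ** B) ** (P ** P - B ** B)))"
proof -
  have h: "dagger P = P" "dagger B = B" using assms psd_hermitian by auto
  have "0 \<le> Re (trace (P ** (D ** (B ** D))))"
    using assms h by (intro trace_psd_conj_nonneg) (simp_all add: dagger_diff)
  moreover have "0 \<le> Re (trace (dagger (P ** B - B ** P) ** (P ** B - B ** P)))"
    unfolding trace_dagger_mult_self by (simp add: sum_nonneg del: of_real_sum)
  moreover
  have c: "trace (X ** Y) = trace (Y ** X)" for X Y :: "complex^'n^'n" by (rule trace_mul_sym)
  \<comment> \<open>Up to cyclic rotation there are six words of length four in \<open>P\<close> and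
    \<open>B\<close>; these rules bring the mixed words to one representative of each class.\<close>
  have r:
    "trace (B ** (P ** (P ** P))) = trace (P ** (P ** (P ** B)))"
    "trace (P ** (B ** (P ** P))) = trace (P ** (P ** (P ** B)))"
    "trace (P ** (P ** (B ** P))) = trace (P ** (P ** (P ** B)))"
    "trace (B ** (P ** (B ** B))) = trace (P ** (B ** (B ** B)))"
    "trace (B ** (B ** (P ** B))) = trace (P ** (B ** (B ** B)))"
    "trace (B ** (B ** (B ** P))) = trace (P ** (B ** (B ** B)))"
    "trace (P ** (B ** (B ** P))) = trace (P ** (P ** (B ** B)))"
    "trace (B ** (B ** (P ** P))) = trace (P ** (P ** (B ** B)))"
    "trace (B ** (P ** (P ** B))) = trace (P ** (P ** (B ** B)))"
    "trace (B ** (P ** (B ** P))) = trace (P ** (B ** (P ** B)))"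
    using c[of B "P ** (P ** P)"] c[of "P ** B" "P ** P"] c[of "P ** P ** B" P]
      c[of "B" "P ** (B ** B)"] c[of "B ** B" "P ** B"] c[of "B ** (B ** B)" P]
      c[of "P ** B ** B" P] c[of "B ** B" "P ** P"] c[of "B" "P ** P ** B"] c[of B "P ** B ** P"]
    by (simp_all only: matrix_mul_assoc)
  note exp = matrix_diff_ldistrib matrix_diff_rdistrib matrix_mul_assoc[symmetric]
  have "trace (P ** (D ** (B ** D))) =
      trace (P ** (P ** (P ** B))) - 2 * trace (P ** (P ** (B ** B))) + trace (P ** (B ** (B ** B)))"
    by (simp only: D_def exp trace_sub r) simp
  moreover have "trace (dagger (P ** B - B ** P) ** (P ** B - B ** P)) =
      2 * trace (P ** (P ** (B ** B))) - 2 * trace (P ** (B ** (P ** B)))"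
    by (simp only: dagger_diff dagger_mult h exp trace_sub r) simp
  moreover have "trace ((D ** D) ** (D ** D)) = trace (P ** (P ** (P ** P)))
      - 4 * trace (P ** (P ** (P ** B))) - 4 * trace (P ** (B ** (B ** B)))
      + 4 * trace (P ** (P ** (B ** B))) + 2 * trace (P ** (B ** (P ** B))) + trace (B ** (B ** (B ** B)))"
    by (simp only: D_def exp trace_sub r) simp
  moreover have "trace ((P ** P - B ** B) ** (P ** P - B ** B)) = trace (P ** (P ** (P ** P)))
      - 2 * trace (P ** (P ** (B ** B))) + trace (B ** (B ** (B ** B)))"
    by (simp only: exp trace_sub r) simp
  ultimately show ?thesis by simp
qed

section \<open>Channels and fidelities\<close>

definition mat_unit :: "'a \<Rightarrow> 'a \<Rightarrow> complex^'a^'a" where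
  "mat_unit k k' = (\<chi> a a'. if a = k \<and> a' = k' then 1 else 0)"

lemma mat_unit_nth: "mat_unit k k' $ a $ a' = (if a = k then if a' = k' then 1 else 0 else 0)"
  by (simp add: mat_unit_def)

text \<open>The outermost conditional decides which summation index can be eliminated first, so both
  nestings are provided.\<close>

lemma mat_unit_nth_swap: "mat_unit k k' $ a $ a' = (if a' = k' then if a = k then 1 else 0 else 0)"
  by (simp add: mat_unit_def)

lemma sum_UNIV_prod: "(\<Sum>p\<in>UNIV. f p) = (\<Sum>a\<in>UNIV. \<Sum>b\<in>UNIV. f (a, b))"
  for f :: "'a::finite \<times> 'b::finite \<Rightarrow> 'c::comm_monoid_add"
  by (simp add: sum.cartesian_product)

lemma sum_nonneg_Reals: "(\<And>i. i \<in> I \<Longrightarrow> f i \<in> \<real>\<^sub>\<ge>\<^sub>0) \<Longrightarrow> sum f I \<in> \<real>\<^sub>\<ge>\<^sub>0"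
  for f :: "'i \<Rightarrow> complex"
  by (induction I rule: infinite_finite_induct) auto

lemma trace_ketbra: "trace (ketbra u) = of_real ((norm u)\<^sup>2)"
  by (simp add: trace_def mult_cnj_cmod norm_vec_def L2_set_def sum_nonneg)

text \<open>The block of \<open>ketbra max_entangled\<close> at reference indices \<open>k\<close>,
  \<open>k'\<close> is \<open>1/d\<close> times a matrix unit, and the outer vectors pick one entry
  of its image with a further factor \<open>1/d\<close>. The sum is the value of the Choi matrix at
  the unnormalised maximally entangled vector.\<close>

lemma entanglement_fidelity_eq:
  fixes \<Phi> :: "complex^'l^'l \<Rightarrow> complex^'l^'l"
  assumes "\<And>c X. \<Phi> (mat_scale c X) = mat_scale c (\<Phi> X)"
  shows "entanglement_fidelity \<Phi> =
    sqrt (Re (\<Sum>k\<in>UNIV. \<Sum>k'\<in>UNIV. \<Phi> (mat_unit k k') $ k $ k')) / real CARD('l)"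
proof -
  define d where "d = real CARD('l)"
  define \<psi> :: "complex^('l \<times> 'l)" where "\<psi> = max_entangled"
  have d: "d > 0" by (simp add: d_def)
  then have dd: "(1 / complex_of_real (sqrt d)) * (1 / complex_of_real (sqrt d)) = 1 / of_real d"
    by (simp flip: of_real_mult)
  have psi: "\<psi> $ (a, b) = (if a = b then 1 / complex_of_real (sqrt d) else 0)" for a b
    by (simp add: \<psi>_def max_entangled_def tensor_vec_def axis_def d_def
        if_distrib[of "\<lambda>x. _ * x"] cong: if_cong)
  have T: "tensor_id \<Phi> (ketbra \<psi>) $ p $ q = 1 / of_real d * \<Phi> (mat_unit (snd p) (snd q)) $ fst p $ fst q" for p q
  proof -
    have "(\<chi> a a'. ketbra \<psi> $ (a, snd p) $ (a', snd q)) = mat_scale (1 / of_real d) (mat_unit (snd p) (snd q))"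
      using dd by (simp add: vec_eq_iff psi mat_unit_nth)
    then show ?thesis by (simp add: tensor_id_def assms)
  qed
  have "cinner \<psi> (tensor_id \<Phi> (ketbra \<psi>) *v \<psi>) =
      (\<Sum>p\<in>UNIV. \<Sum>q\<in>UNIV. cnj (\<psi> $ p) * (tensor_id \<Phi> (ketbra \<psi>) $ p $ q * \<psi> $ q))"
    by (simp add: cinner_def matrix_vector_mult_nth sum_distrib_left)
  also have "\<dots> = (\<Sum>a\<in>UNIV. \<Sum>b\<in>UNIV. \<Sum>a'\<in>UNIV. \<Sum>b'\<in>UNIV.
      cnj (\<psi> $ (a, b)) * (tensor_id \<Phi> (ketbra \<psi>) $ (a, b) $ (a', b') * \<psi> $ (a', b')))"
    by (simp only: sum_UNIV_prod)
  also have "\<dots> = (\<Sum>k\<in>UNIV. \<Sum>k'\<in>UNIV. \<Phi> (mat_unit k k') $ k $ k' / (of_real d)\<^sup>2)"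
  proof (rule sum.cong[OF refl])
    fix k :: 'l
    have "(\<Sum>b\<in>UNIV. \<Sum>a'\<in>UNIV. \<Sum>b'\<in>UNIV.
      cnj (\<psi> $ (k, b)) * (tensor_id \<Phi> (ketbra \<psi>) $ (k, b) $ (a', b') * \<psi> $ (a', b'))) =
      (\<Sum>b\<in>UNIV. cnj (\<psi> $ (k, b)) * (\<Sum>a'\<in>UNIV. \<Sum>b'\<in>UNIV.
        tensor_id \<Phi> (ketbra \<psi>) $ (k, b) $ (a', b') * \<psi> $ (a', b')))"
      by (simp add: sum_distrib_left)
    also have "\<dots> = 1 / of_real (sqrt d) * (\<Sum>k'\<in>UNIV.
        tensor_id \<Phi> (ketbra \<psi>) $ (k, k) $ (k', k') * (1 / of_real (sqrt d)))"
      by (simp add: psi if_distrib[of "\<lambda>x. _ * x"] if_distrib[of "\<lambda>x. x * _"] if_distrib[of cnj] cong: if_cong)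
    also have "\<dots> = (\<Sum>k'\<in>UNIV. (1 / of_real (sqrt d) * (1 / of_real (sqrt d))) *
        tensor_id \<Phi> (ketbra \<psi>) $ (k, k) $ (k', k'))"
      by (simp add: sum_distrib_left)
    also have "\<dots> = (\<Sum>k'\<in>UNIV. \<Phi> (mat_unit k k') $ k $ k' / (of_real d)\<^sup>2)"
      unfolding dd T by (simp add: power2_eq_square)
    finally show "(\<Sum>b\<in>UNIV. \<Sum>a'\<in>UNIV. \<Sum>b'\<in>UNIV.
      cnj (\<psi> $ (k, b)) * (tensor_id \<Phi> (ketbra \<psi>) $ (k, b) $ (a', b') * \<psi> $ (a', b'))) =
      (\<Sum>k'\<in>UNIV. \<Phi> (mat_unit k k') $ k $ k' / (of_real d)\<^sup>2)" .
  qed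
  also have "\<dots> = (\<Sum>k\<in>UNIV. \<Sum>k'\<in>UNIV. \<Phi> (mat_unit k k') $ k $ k') / of_real (d\<^sup>2)"
    by (simp add: sum_divide_distrib)
  finally show ?thesis
    using d unfolding entanglement_fidelity_def \<psi>_def[symmetric] d_def[symmetric]
    by (simp only: Re_divide_of_real) (simp add: real_sqrt_divide)
qed

text \<open>The double sum over diagonal entries factors, so each Kraus operator contributes
  \<open>|tr M_b|^2\<close>.\<close>

lemma entanglement_fidelity_kraus:
  fixes M :: "'i \<Rightarrow> complex^'l^'l"
  assumes "\<And>X. \<Phi> X = (\<Sum>b\<in>I. M b ** X ** dagger (M b))"
  shows "entanglement_fidelity \<Phi> = sqrt (\<Sum>b\<in>I. (cmod (trace (M b)))\<^sup>2) / real CARD('l)"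
proof -
  have lin: "\<Phi> (mat_scale c X) = mat_scale c (\<Phi> X)" for c X
    by (simp add: assms vec_eq_iff mat_scale_mult_left mat_scale_mult_right sum_component sum_distrib_left)
  have "(M b ** mat_unit k k' ** dagger (M b)) $ k $ k' = M b $ k $ k * cnj (M b $ k' $ k')" for b k k'
    by (simp add: matrix_mult_nth mat_unit_nth if_distrib[of "\<lambda>x. _ * x"] if_distrib[of "\<lambda>x. x * _"] cong: if_cong)
  then have "(\<Sum>k\<in>UNIV. \<Sum>k'\<in>UNIV. \<Phi> (mat_unit k k') $ k $ k') =
      (\<Sum>k\<in>UNIV. \<Sum>k'\<in>UNIV. \<Sum>b\<in>I. M b $ k $ k * cnj (M b $ k' $ k'))"
    by (simp add: assms sum_component)
  also have "\<dots> = (\<Sum>b\<in>I. \<Sum>k\<in>UNIV. \<Sum>k'\<in>UNIV. M b $ k $ k * cnj (M b $ k' $ k'))"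
    by (subst sum.swap[of _ I], subst sum.swap[of _ I]) simp
  also have "\<dots> = (\<Sum>b\<in>I. trace (M b) * cnj (trace (M b)))"
    by (simp add: trace_def sum_product)
  also have "\<dots> = of_real (\<Sum>b\<in>I. (cmod (trace (M b)))\<^sup>2)"
    by (simp add: mult_cnj_cmod)
  finally show ?thesis
    unfolding entanglement_fidelity_eq[OF lin] by (simp only: Re_complex_of_real)
qed

text \<open>The block form of the image at the vectors \<open>v i\<close> is the sum over
  \<open>b\<close> of the block forms of \<open>X\<close> at \<open>dagger (R b) *v v i\<close>,
  which gives complete positivity. Trace preservation is cyclicity of the trace.\<close>

lemma kraus_channel:
  fixes R :: "'i \<Rightarrow> complex^'a^'b"
  assumes "(\<Sum>b\<in>I. dagger (R b) ** R b) = mat 1"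
  shows "channel (\<lambda>X. \<Sum>b\<in>I. R b ** X ** dagger (R b))"
  unfolding channel_def
proof (intro conjI allI)
  fix X Y c
  show "(\<Sum>b\<in>I. R b ** (X + Y) ** dagger (R b)) =
      (\<Sum>b\<in>I. R b ** X ** dagger (R b)) + (\<Sum>b\<in>I. R b ** Y ** dagger (R b))"
    by (simp add: matrix_add_ldistrib matrix_add_rdistrib sum.distrib)
  show "(\<Sum>b\<in>I. R b ** mat_scale c X ** dagger (R b)) = mat_scale c (\<Sum>b\<in>I. R b ** X ** dagger (R b))"
    by (simp add: vec_eq_iff mat_scale_mult_left mat_scale_mult_right sum_component sum_distrib_left)
  have "trace (\<Sum>b\<in>I. R b ** X ** dagger (R b)) = (\<Sum>b\<in>I. trace (dagger (R b) ** R b ** X))"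
    by (simp add: trace_sum matrix_mul_assoc trace_mul_sym[of "_ ** _" "dagger _"])
  also have "\<dots> = trace X"
    by (simp add: assms flip: trace_sum matrix_mult_sum_left)
  finally show "trace (\<Sum>b\<in>I. R b ** X ** dagger (R b)) = trace X" .
next
  show "completely_positive (\<lambda>X. \<Sum>b\<in>I. R b ** X ** dagger (R b))"
    unfolding completely_positive_def
  proof (intro allI impI)
    fix k X assume X: "psd_blocks k (X :: nat \<Rightarrow> nat \<Rightarrow> complex^'a^'a)"
    have ci: "cinner u ((\<Sum>b\<in>I. f b) *v w) = (\<Sum>b\<in>I. cinner u (f b *v w))" for u w :: "complex^'b" and f
      by (induction I rule: infinite_finite_induct)
        (simp_all add: matrix_vector_mult_add_rdistrib cinner_def distrib_left sum.distrib)
    show "psd_blocks k (\<lambda>i j. \<Sum>b\<in>I. R b ** X i j ** dagger (R b))"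
      unfolding psd_blocks_def
    proof
      fix v :: "nat \<Rightarrow> complex^'b"
      have "(\<Sum>i<k. \<Sum>j<k. cinner (v i) ((\<Sum>b\<in>I. R b ** X i j ** dagger (R b)) *v v j)) =
          (\<Sum>i<k. \<Sum>j<k. \<Sum>b\<in>I. cinner (dagger (R b) *v v i) (X i j *v (dagger (R b) *v v j)))"
        by (simp add: ci cinner_dagger[of _ "R _"] flip: matrix_vector_mul_assoc)
      also have "\<dots> = (\<Sum>b\<in>I. \<Sum>i<k. \<Sum>j<k. cinner (dagger (R b) *v v i) (X i j *v (dagger (R b) *v v j)))"
        by (subst sum.swap[of _ I], subst sum.swap[of _ I]) simp
      also have "\<dots> \<in> \<real>\<^sub>\<ge>\<^sub>0"
        by (rule sum_nonneg_Reals, rule X[unfolded psd_blocks_def, rule_format])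
      finally show "(\<Sum>i<k. \<Sum>j<k. cinner (v i) ((\<Sum>b\<in>I. R b ** X i j ** dagger (R b)) *v v j)) \<in> \<real>\<^sub>\<ge>\<^sub>0" .
    qed
  qed
qed

section \<open>The maximum over recovery channels is attained\<close>

text \<open>The linear map with Choi matrix \<open>J\<close>, indexed by pairs (output, input). It
  makes channels points of a finite-dimensional space, where compactness is available.\<close>

definition choi_map :: "complex^('b::finite \<times> 'a::finite)^('b \<times> 'a) \<Rightarrow> complex^'a^'a \<Rightarrow> complex^'b^'b" where
  "choi_map J X = (\<chi> i j. \<Sum>k\<in>UNIV. \<Sum>k'\<in>UNIV. X $ k $ k' * J $ (i, k) $ (j, k'))"

lemma additive_sum:
  assumes "\<And>X Y. \<Phi> (X + Y) = \<Phi> X + \<Phi> Y" "\<Phi> 0 = 0"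
  shows "\<Phi> (sum f I) = (\<Sum>i\<in>I. \<Phi> (f i))"
  by (induction I rule: infinite_finite_induct) (simp_all add: assms)

lemma channel_choi_map:
  fixes \<Phi> :: "complex^'a^'a \<Rightarrow> complex^'b^'b"
  assumes "channel \<Phi>"
  shows "\<Phi> = choi_map (\<chi> p q. \<Phi> (mat_unit (snd p) (snd q)) $ fst p $ fst q)"
proof
  fix X :: "complex^'a^'a"
  have add: "\<Phi> (X + Y) = \<Phi> X + \<Phi> Y" and sc: "\<Phi> (mat_scale c X) = mat_scale c (\<Phi> X)" for X Y c
    using assms by (auto simp: channel_def)
  have z: "mat_scale 0 Y = 0" for Y :: "complex^'n^'m" by (simp add: vec_eq_iff)
  have "\<Phi> 0 = 0" using sc[of 0 0] by (simp only: z)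
  note S = additive_sum[of \<Phi>, OF add this]
  have "X = (\<Sum>k\<in>UNIV. \<Sum>k'\<in>UNIV. mat_scale (X $ k $ k') (mat_unit k k'))"
    by (simp add: vec_eq_iff sum_component mat_unit_nth_swap if_distrib[of "\<lambda>x. _ * x"] cong: if_cong)
  then have "\<Phi> X = \<Phi> (\<Sum>k\<in>UNIV. \<Sum>k'\<in>UNIV. mat_scale (X $ k $ k') (mat_unit k k'))"
    by (rule arg_cong)
  also have "\<dots> = (\<Sum>k\<in>UNIV. \<Sum>k'\<in>UNIV. mat_scale (X $ k $ k') (\<Phi> (mat_unit k k')))"
    by (simp only: S sc)
  finally show "\<Phi> X = choi_map (\<chi> p q. \<Phi> (mat_unit (snd p) (snd q)) $ fst p $ fst q) X"
    by (simp add: choi_map_def vec_eq_iff sum_component)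
qed

text \<open>Complete positivity in the case of a single block.\<close>

lemma channel_psd:
  assumes "channel \<Phi>" "psd X"
  shows "psd (\<Phi> X)"
proof -
  have "psd_blocks 1 (\<lambda>_ _. X)" using assms(2) by (simp add: psd_blocks_def psd_def)
  then have *: "psd_blocks 1 (\<lambda>_ _. \<Phi> X)"
    using assms(1) by (simp add: channel_def completely_positive_def)
  show ?thesis
    unfolding psd_def using *[unfolded psd_blocks_def, rule_format, of "\<lambda>_. _"] by simp
qed

text \<open>An entry of a rank-one term \<open>ketbra v\<close> has modulus at most the squared norm
  of \<open>v\<close>, which is the trace of the term; a positive semidefinite matrix is a sum of
  such terms.\<close>

lemma psd_cmod_le_trace:
  fixes M :: "complex^'n^'n"
  assumes "psd M"
  shows "cmod (M $ i $ j) \<le> Re (trace M)"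
proof -
  obtain v :: "'n \<Rightarrow> complex^'n" where v: "M = (\<Sum>c\<in>UNIV. ketbra (v c))"
    using psd_ketbra_decomposition[OF assms] by blast
  have "trace M = of_real (\<Sum>c\<in>UNIV. (norm (v c))\<^sup>2)"
    by (simp add: v trace_sum trace_ketbra)
  moreover have "cmod (M $ i $ j) \<le> (\<Sum>c\<in>UNIV. (norm (v c))\<^sup>2)"
  proof -
    have "cmod (M $ i $ j) \<le> (\<Sum>c\<in>UNIV. cmod (ketbra (v c) $ i $ j))"
      unfolding v sum_component by (rule norm_sum)
    also have "\<dots> \<le> (\<Sum>c\<in>UNIV. (norm (v c))\<^sup>2)"
      by (intro sum_mono) (auto simp: norm_mult power2_eq_square intro!: mult_mono Finite_Cartesian_Product.norm_nth_le)
    finally show ?thesis .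
  qed
  ultimately show ?thesis by simp
qed

text \<open>By polarisation a matrix unit is \<open>1/4\<close> times a combination, with
  coefficients of modulus 1, of four rank-one operators of trace at most 4. A channel keeps them
  positive and keeps their traces, so the entries of their images have modulus at most 4.\<close>

lemma channel_mat_unit_bound:
  assumes "channel \<Phi>"
  shows "cmod (\<Phi> (mat_unit k k') $ i $ j) \<le> 4"
proof -
  have add: "\<Phi> (X + Y) = \<Phi> X + \<Phi> Y" and sc: "\<Phi> (mat_scale c X) = mat_scale c (\<Phi> X)"
    and tr: "trace (\<Phi> X) = trace X" for X Y c
    using assms by (auto simp: channel_def)
  define K where "K w = ketbra (axis k 1 + w *s axis k' 1)" for w :: complex
  have "mat_unit k k' = mat_scale (1/4) (K 1) + mat_scale (-1/4) (K (-1)) +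
      mat_scale (\<i>/4) (K \<i>) + mat_scale (-\<i>/4) (K (-\<i>))"
    by (auto simp: vec_eq_iff K_def mat_unit_nth axis_def complex_eq_iff)
  then have e: "\<Phi> (mat_unit k k') $ i $ j = 1/4 * \<Phi> (K 1) $ i $ j + (-1/4) * \<Phi> (K (-1)) $ i $ j
      + \<i>/4 * \<Phi> (K \<i>) $ i $ j + (-\<i>/4) * \<Phi> (K (-\<i>)) $ i $ j"
    by (simp add: add sc)
  have b: "cmod (\<Phi> (K w) $ i $ j) \<le> 4" if "cmod w = 1" for w
  proof -
    have "cmod (\<Phi> (K w) $ i $ j) \<le> Re (trace (K w))"
      using psd_cmod_le_trace[OF channel_psd[OF assms psd_ketbra]] unfolding K_def tr .
    also have "\<dots> = (norm (axis k 1 + w *s axis k' 1))\<^sup>2"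
      by (simp add: K_def trace_ketbra)
    also have "\<dots> \<le> 2\<^sup>2"
    proof (rule power_mono)
      have "w *s axis k' 1 = axis k' w" by (simp add: vec_eq_iff axis_def)
      moreover have "norm (axis k' w) = cmod w"
        by (simp add: norm_vec_def L2_set_def axis_def if_distrib[of norm] if_distrib[of "\<lambda>x. x\<^sup>2"] cong: if_cong)
      ultimately show "norm (axis k 1 + w *s axis k' 1) \<le> 2"
        using norm_triangle_ineq[of "axis k (1::complex)" "axis k' w"] that by simp
    qed simp
    finally show ?thesis by simp
  qed
  have "cmod (\<Phi> (mat_unit k k') $ i $ j) \<le> cmod (1/4 * \<Phi> (K 1) $ i $ j) + cmod ((-1/4) * \<Phi> (K (-1)) $ i $ j)
      + cmod (\<i>/4 * \<Phi> (K \<i>) $ i $ j) + cmod ((-\<i>/4) * \<Phi> (K (-\<i>)) $ i $ j)"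
    unfolding e by (meson add_mono norm_triangle_ineq order_trans order_refl)
  also have "\<dots> \<le> 4" using b[of 1] b[of "-1"] b[of \<i>] b[of "-\<i>"] by (simp add: norm_mult norm_divide)
  finally show ?thesis .
qed

text \<open>For fixed test data each positivity and trace condition is closed in \<open>J\<close>,
  and \<open>choi_map J\<close> is linear for every \<open>J\<close>. The entries of
  \<open>J\<close> are entries of images of matrix units, hence bounded.\<close>

lemma compact_channel_choi:
  "compact {J :: complex^('b::finite \<times> 'a::finite)^('b \<times> 'a). channel (choi_map J)}"
proof -
  let ?S = "{J :: complex^('b \<times> 'a)^('b \<times> 'a). channel (choi_map J)}"
  have lin: "choi_map J (X + Y) = choi_map J X + choi_map J Y"
    "choi_map J (mat_scale c X) = mat_scale c (choi_map J X)"
    for J :: "complex^('b \<times> 'a)^('b \<times> 'a)" and X Y c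
    by (simp_all add: choi_map_def vec_eq_iff distrib_right sum.distrib sum_distrib_left mult.assoc)
  have S: "?S = {J. \<forall>k X. psd_blocks k X \<longrightarrow>
      (\<forall>v. 0 \<le> Re (\<Sum>i<k. \<Sum>j<k. cinner (v i) (choi_map J (X i j) *v v j)) \<and>
           Im (\<Sum>i<k. \<Sum>j<k. cinner (v i) (choi_map J (X i j) *v v j)) = 0)}
      \<inter> {J. \<forall>X. trace (choi_map J X) = trace X}"
    by (auto simp: channel_def completely_positive_def psd_blocks_def lin complex_nonneg_Reals_iff
        simp del: Re_sum Im_sum)
  have imp: "closed {J. P \<longrightarrow> Q J}" if "closed {J. Q J}" for P and Q :: "complex^('b \<times> 'a)^('b \<times> 'a) \<Rightarrow> bool"
    using that by (cases P) auto
  have "closed ?S"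
    unfolding S cinner_def matrix_vector_mult_nth choi_map_def vec_lambda_beta trace_def
    by (intro closed_Int closed_Collect_all imp closed_Collect_conj closed_Collect_le closed_Collect_eq
        continuous_intros)
  moreover have "bounded ?S"
  proof (rule boundedI)
    fix J assume "J \<in> ?S"
    then have ch: "channel (choi_map J)" by simp
    have "choi_map J (mat_unit k k') $ i $ j = J $ (i, k) $ (j, k')" for i j k k'
      by (simp add: choi_map_def mat_unit_nth_swap if_distrib[of "\<lambda>x. x * _"] cong: if_cong)
    then have 4: "cmod (J $ p $ q) \<le> 4" for p q
      using channel_mat_unit_bound[OF ch, of "snd p" "snd q" "fst p" "fst q"] by simp
    have "norm J \<le> (\<Sum>i\<in>UNIV. norm (J $ i))" by (simp add: norm_vec_def L2_set_le_sum)
    also have "\<dots> \<le> (\<Sum>i\<in>UNIV. \<Sum>j\<in>UNIV. cmod (J $ i $ j))"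
      by (intro sum_mono) (simp add: norm_vec_def L2_set_le_sum)
    also have "\<dots> \<le> (\<Sum>i\<in>(UNIV :: ('b \<times> 'a) set). \<Sum>j\<in>(UNIV :: ('b \<times> 'a) set). 4)" by (intro sum_mono 4)
    finally show "norm J \<le> (\<Sum>i\<in>(UNIV :: ('b \<times> 'a) set). \<Sum>j\<in>(UNIV :: ('b \<times> 'a) set). 4)" .
  qed
  ultimately show ?thesis by (simp add: compact_eq_bounded_closed)
qed

text \<open>The fidelity is continuous in the Choi matrix of the recovery, and the Choi matrices of
  channels form a compact set; so the maximum is attained and \<open>GREATEST\<close> has its
  intended value.\<close>

lemma recovery_fidelity_ge:
  fixes \<Lambda> :: "complex^'l^'l \<Rightarrow> complex^'s^'s"
  assumes "\<And>c X. \<Lambda> (mat_scale c X) = mat_scale c (\<Lambda> X)" and "channel \<R>"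
  shows "entanglement_fidelity (\<R> \<circ> \<Lambda>) \<le> recovery_fidelity \<Lambda>"
proof -
  let ?S = "{J :: complex^('l \<times> 's)^('l \<times> 's). channel (choi_map J)}"
  let ?f = "\<lambda>J. entanglement_fidelity (choi_map J \<circ> \<Lambda>)"
  have f: "?f J = sqrt (Re (\<Sum>k\<in>UNIV. \<Sum>k'\<in>UNIV. choi_map J (\<Lambda> (mat_unit k k')) $ k $ k')) / real CARD('l)"
    if "channel (choi_map J)" for J
    using that assms(1) by (subst entanglement_fidelity_eq) (simp_all add: channel_def)
  have "continuous_on ?S (\<lambda>J. sqrt (Re (\<Sum>k\<in>UNIV. \<Sum>k'\<in>UNIV. choi_map J (\<Lambda> (mat_unit k k')) $ k $ k')) / real CARD('l))"
    unfolding choi_map_def vec_lambda_beta by (intro continuous_intros) auto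
  then have "continuous_on ?S ?f" by (rule continuous_on_eq) (simp add: f)
  moreover have ex: "\<exists>J\<in>?S. \<R>' = choi_map J" if "channel \<R>'" for \<R>' :: "complex^'s^'s \<Rightarrow> complex^'l^'l"
    using that channel_choi_map[OF that, symmetric]
    by (intro bexI[of _ "\<chi> p q. \<R>' (mat_unit (snd p) (snd q)) $ fst p $ fst q"]) simp_all
  then have "?S \<noteq> {}" using assms(2) by blast
  ultimately obtain J where J: "J \<in> ?S" and max: "\<forall>J'\<in>?S. ?f J' \<le> ?f J"
    using continuous_attains_sup[OF compact_channel_choi] by blast
  have "recovery_fidelity \<Lambda> = ?f J"
    unfolding recovery_fidelity_def
  proof (rule Greatest_equality)
    show "\<exists>\<R>. channel \<R> \<and> ?f J = entanglement_fidelity (\<R> \<circ> \<Lambda>)" using J by blast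
  qed (use ex max in blast)
  then show ?thesis using ex[OF assms(2)] max by auto
qed

section \<open>Support arguments and Cauchy-Schwarz estimates\<close>

text \<open>For hermitian \<open>P\<close> the diagonal entry of \<open>P ** P\<close> at
  \<open>x\<close> is the squared norm of row \<open>x\<close>.\<close>

lemma hermitian_square_diag_zero:
  assumes "dagger P = P" "(P ** P) $ x $ x = 0"
  shows "P $ x $ y = 0" "P $ y $ x = 0"
proof -
  have h: "P $ y $ x = cnj (P $ x $ y)" for y using assms(1) by (metis dagger_nth)
  have "(P ** P) $ x $ x = of_real (\<Sum>y\<in>UNIV. (cmod (P $ x $ y))\<^sup>2)"
    by (simp add: matrix_mult_nth h mult_cnj_cmod)
  then have "(\<Sum>y\<in>UNIV. (cmod (P $ x $ y))\<^sup>2) = 0" using assms(2) by (metis of_real_eq_0_iff)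
  then show "P $ x $ y = 0" by (subst (asm) sum_nonneg_eq_0_iff) auto
  then show "P $ y $ x = 0" by (simp add: h)
qed

text \<open>Cauchy-Schwarz for the diagonal of \<open>D ** D\<close> against the constant 1 on
  \<open>Z\<close>; the squared diagonal entries sum to at most the squared Hilbert-Schmidt norm of
  \<open>D ** D\<close>. The size of the support enters, not the full dimension.\<close>

lemma trace_square_le:
  fixes D :: "complex^'n^'n"
  assumes "dagger D = D" "\<And>x y. x \<notin> Z \<Longrightarrow> D $ x $ y = 0"
  shows "Re (trace (D ** D)) \<le> sqrt (card Z) * sqrt (Re (trace ((D ** D) ** (D ** D))))"
proof -
  let ?f = "\<lambda>x. Re ((D ** D) $ x $ x)"
  have "Re (trace (D ** D)) = (\<Sum>x\<in>Z. ?f x)"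
    unfolding trace_def Re_sum
    by (intro sum.mono_neutral_right) (auto simp: matrix_mult_nth assms(2))
  also have "\<dots> \<le> sqrt ((\<Sum>x\<in>Z. 1 * ?f x)\<^sup>2)" by simp
  also have "\<dots> \<le> sqrt ((\<Sum>x\<in>Z. 1\<^sup>2) * (\<Sum>x\<in>Z. (?f x)\<^sup>2))"
    by (intro real_sqrt_le_mono Cauchy_Schwarz_ineq_sum)
  also have "\<dots> = sqrt (card Z) * sqrt (\<Sum>x\<in>Z. (?f x)\<^sup>2)" by (simp add: real_sqrt_mult)
  also have "\<dots> \<le> sqrt (card Z) * sqrt (Re (trace ((D ** D) ** (D ** D))))"
  proof (intro mult_left_mono real_sqrt_le_mono)
    have "(\<Sum>x\<in>Z. (?f x)\<^sup>2) \<le> (\<Sum>x\<in>UNIV. (?f x)\<^sup>2)" by (intro sum_mono2) auto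
    also have "\<dots> \<le> (\<Sum>x\<in>UNIV. \<Sum>y\<in>UNIV. (cmod ((D ** D) $ x $ y))\<^sup>2)"
    proof (intro sum_mono)
      fix x
      have "(?f x)\<^sup>2 \<le> (cmod ((D ** D) $ x $ x))\<^sup>2" using abs_Re_le_cmod by (metis abs_le_square_iff abs_norm_cancel)
      also have "\<dots> \<le> (\<Sum>y\<in>UNIV. (cmod ((D ** D) $ x $ y))\<^sup>2)"
        using member_le_sum[of x UNIV "\<lambda>y. (cmod ((D ** D) $ x $ y))\<^sup>2"] by simp
      finally show "(?f x)\<^sup>2 \<le> (\<Sum>y\<in>UNIV. (cmod ((D ** D) $ x $ y))\<^sup>2)" .
    qed
    also have "\<dots> = Re (trace (dagger (D ** D) ** (D ** D)))"
      unfolding trace_dagger_mult_self by (simp only: Re_complex_of_real)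
    finally show "(\<Sum>x\<in>Z. (?f x)\<^sup>2) \<le> Re (trace ((D ** D) ** (D ** D)))"
      by (simp add: dagger_mult assms(1))
  qed simp
  finally show ?thesis .
qed

lemma cmod_sum_mult_le:
  fixes a b :: "'i \<Rightarrow> complex"
  shows "cmod (\<Sum>i\<in>I. a i * b i) \<le> sqrt (\<Sum>i\<in>I. (cmod (a i))\<^sup>2) * sqrt (\<Sum>i\<in>I. (cmod (b i))\<^sup>2)"
proof -
  have "cmod (\<Sum>i\<in>I. a i * b i) \<le> (\<Sum>i\<in>I. \<bar>cmod (a i)\<bar> * \<bar>cmod (b i)\<bar>)"
    using norm_sum[of "\<lambda>i. a i * b i" I] by (simp add: norm_mult)
  also have "\<dots> \<le> L2_set (\<lambda>i. cmod (a i)) I * L2_set (\<lambda>i. cmod (b i)) I"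
    by (rule L2_set_mult_ineq)
  finally show ?thesis by (simp add: L2_set_def)
qed

text \<open>\<open>B\<close> is \<open>\<tau> / r\<close> tensored with the identity, so its form is
  the sum over \<open>l\<close> of the form of \<open>\<tau> / r\<close> at the slices of
  \<open>v\<close>.\<close>

lemma psd_tensor_id:
  fixes \<tau> :: "complex^'k^'k" and B :: "complex^('k::finite \<times> 'l::finite)^('k \<times> 'l)"
  assumes "psd \<tau>" "0 \<le> r" "\<And>c l c' l'. B $ (c, l) $ (c', l') = (if l = l' then \<tau> $ c $ c' / of_real r else 0)"
  shows "psd B"
  unfolding psd_def
proof
  fix v :: "complex^('k \<times> 'l)"
  have "cinner v (B *v v) = (\<Sum>l\<in>UNIV. \<Sum>c\<in>UNIV. cnj (v $ (c, l)) * (\<Sum>c'\<in>UNIV. \<tau> $ c $ c' / of_real r * v $ (c', l)))"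
    by (simp add: cinner_def matrix_vector_mult_nth sum_UNIV_prod assms(3) if_distrib[of "\<lambda>x. x * _"] cong: if_cong)
       (rule sum.swap)
  also have "\<dots> = (\<Sum>l\<in>UNIV. cinner (\<chi> c. v $ (c, l)) (\<tau> *v (\<chi> c. v $ (c, l))) / of_real r)"
    by (simp add: cinner_def matrix_vector_mult_nth sum_distrib_left sum_divide_distrib)
  also have "\<dots> \<in> \<real>\<^sub>\<ge>\<^sub>0"
    using psdD[OF assms(1)] assms(2) by (intro sum_nonneg_Reals nonneg_Reals_divide_I) simp_all
  finally show "cinner v (B *v v) \<in> \<real>\<^sub>\<ge>\<^sub>0" .
qed

section \<open>The recovery channel\<close>

text \<open>The block \<open>c\<close> of \<open>W\<close> is read as a Kraus operator from
  \<open>S\<close> to \<open>L\<close>, and \<open>V\<close> supplies the operators that complete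
  the family to a channel. The left-hand side keeps the contributions of \<open>W\<close>; those of
  \<open>V\<close> are nonnegative.\<close>

lemma recovery_from_contraction:
  fixes K :: "'k::finite \<Rightarrow> complex^'l::finite^'s::finite"
    and W :: "complex^'s^('k \<times> 'l)" and V :: "complex^'s^'s"
  assumes \<Lambda>: "\<And>X. \<Lambda> X = (\<Sum>c\<in>UNIV. K c ** X ** dagger (K c))"
    and W: "dagger W ** W + dagger V ** V = mat 1"
  shows "sqrt (\<Sum>c\<in>UNIV. \<Sum>c'\<in>UNIV. (cmod (\<Sum>l\<in>UNIV. \<Sum>s\<in>UNIV. W $ (c, l) $ s * K c' $ s $ l))\<^sup>2) / CARD('l)
    \<le> recovery_fidelity \<Lambda>"
proof -
  \<comment> \<open>An arbitrary basis index of \<open>L\<close>. Each row of \<open>V\<close>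
    becomes an operator whose range lies along this basis vector, so that the
    \<open>dagger (R b) ** R b\<close> of these operators add up to
    \<open>dagger V ** V\<close>.\<close>
  obtain l0 :: 'l where True by blast
  define R :: "'k + 's \<Rightarrow> complex^'s^'l" where
    "R = case_sum (\<lambda>c. \<chi> l s. W $ (c, l) $ s) (\<lambda>b. \<chi> l s. if l = l0 then V $ b $ s else 0)"
  have R: "R (Inl c) $ l $ s = W $ (c, l) $ s" "R (Inr b) $ l $ s = (if l = l0 then V $ b $ s else 0)" for c b l s
    by (simp_all add: R_def)
  have "(\<Sum>b\<in>UNIV. dagger (R b) ** R b) = dagger W ** W + dagger V ** V"
    by (simp add: vec_eq_iff sum_component sum_UNIV_Plus matrix_mult_nth R sum_UNIV_prod
        if_distrib[of "\<lambda>x. _ * x"] if_distrib[of cnj] cong: if_cong)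
  then have "channel (\<lambda>X. \<Sum>b\<in>UNIV. R b ** X ** dagger (R b))"
    by (intro kraus_channel) (simp add: W)
  moreover have "\<Lambda> (mat_scale c X) = mat_scale c (\<Lambda> X)" for c X
    by (simp add: \<Lambda> vec_eq_iff mat_scale_mult_left mat_scale_mult_right sum_component sum_distrib_left)
  ultimately have "entanglement_fidelity ((\<lambda>X. \<Sum>b\<in>UNIV. R b ** X ** dagger (R b)) \<circ> \<Lambda>) \<le> recovery_fidelity \<Lambda>"
    by (intro recovery_fidelity_ge)
  moreover have "((\<lambda>X. \<Sum>b\<in>UNIV. R b ** X ** dagger (R b)) \<circ> \<Lambda>) X =
      (\<Sum>(b, c)\<in>UNIV. (R b ** K c) ** X ** dagger (R b ** K c))" for X
    by (simp add: sum_UNIV_prod \<Lambda> matrix_mult_sum_left matrix_mult_sum_right dagger_mult matrix_mul_assoc)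
  then have "entanglement_fidelity ((\<lambda>X. \<Sum>b\<in>UNIV. R b ** X ** dagger (R b)) \<circ> \<Lambda>) =
     sqrt (\<Sum>p\<in>UNIV. (cmod (trace (R (fst p) ** K (snd p))))\<^sup>2) / CARD('l)"
    by (intro entanglement_fidelity_kraus) (simp add: case_prod_beta)
  moreover have "trace (R (Inl c) ** K c') = (\<Sum>l\<in>UNIV. \<Sum>s\<in>UNIV. W $ (c, l) $ s * K c' $ s $ l)" for c c'
    by (simp add: trace_def matrix_mult_nth R)
  then have "(\<Sum>c\<in>UNIV. \<Sum>c'\<in>UNIV. (cmod (\<Sum>l\<in>UNIV. \<Sum>s\<in>UNIV. W $ (c, l) $ s * K c' $ s $ l))\<^sup>2) \<le>
     (\<Sum>p\<in>UNIV. (cmod (trace (R (fst p) ** K (snd p))))\<^sup>2)"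
    by (simp add: sum_UNIV_prod sum_UNIV_Plus sum_nonneg)
  then have "sqrt (\<Sum>c\<in>UNIV. \<Sum>c'\<in>UNIV. (cmod (\<Sum>l\<in>UNIV. \<Sum>s\<in>UNIV. W $ (c, l) $ s * K c' $ s $ l))\<^sup>2) / CARD('l)
     \<le> sqrt (\<Sum>p\<in>UNIV. (cmod (trace (R (fst p) ** K (snd p))))\<^sup>2) / CARD('l)"
    by (intro divide_right_mono real_sqrt_le_mono) simp_all
  ultimately show ?thesis by linarith
qed

text \<open>\<open>N\<close> bounds the number of nonzero members rather than the size of
  \<open>'k\<close>, because \<open>P - B\<close> is supported on the indices with
  \<open>K c \<noteq> 0\<close>.\<close>

lemma recovery_fidelity_kraus_bound:
  fixes K :: "'k::finite \<Rightarrow> complex^'l::finite^'s::finite"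
  assumes \<Lambda>: "\<And>X. \<Lambda> X = (\<Sum>c\<in>UNIV. K c ** X ** dagger (K c))"
    and TP: "(\<Sum>c\<in>UNIV. dagger (K c) ** K c) = mat 1"
    and N: "card {c. K c \<noteq> 0} \<le> N"
  defines "d \<equiv> real CARD('l)"
  shows "1 - sqrt (real N / (4 * d)) * sqrt (Re (trace (\<Lambda> (mat 1) ** \<Lambda> (mat 1)))
      - 1 / d * (\<Sum>c\<in>UNIV. \<Sum>c'\<in>UNIV. (cmod (trace (dagger (K c) ** K c')))\<^sup>2))
    \<le> recovery_fidelity \<Lambda>"
proof -
  define S where "S c c' = trace (dagger (K c) ** K c')" for c c'
  define Y where "Y = Re (trace (\<Lambda> (mat 1) ** \<Lambda> (mat 1))) - 1 / d * (\<Sum>c\<in>UNIV. \<Sum>c'\<in>UNIV. (cmod (S c c'))\<^sup>2)"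
  have d: "d > 0" by (simp add: d_def)
  then have sd: "complex_of_real (sqrt d) * complex_of_real (sqrt d) = of_real d"
    by (simp flip: of_real_mult)
  \<comment> \<open>The columns of \<open>T\<close> are the vectorised \<open>K c\<close>, so
    \<open>dagger T ** T\<close> is the Gram matrix \<open>S\<close>. \<open>C\<close> places the
    \<open>K c\<close> side by side, so \<open>dagger C ** C\<close> is the block matrix
    \<open>G\<close> and \<open>C ** dagger C\<close> is \<open>\<Lambda> (mat 1)\<close>; their
    squares have the same trace.\<close>
  define T :: "complex^'k^('s \<times> 'l)" where "T = (\<chi> p c. K c $ fst p $ snd p)"
  define C :: "complex^('k \<times> 'l)^'s" where "C = (\<chi> s p. K (fst p) $ s $ snd p)"
  obtain \<tau> where \<tau>: "psd \<tau>" "\<tau> ** \<tau> = dagger T ** T"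
    using polar_decomposition[of T] by metis
  obtain P W and V :: "complex^'s^'s" where P: "psd P" "P = W ** C" "P ** P = dagger C ** C"
    and W: "dagger W ** W + dagger V ** V = mat 1"
    using polar_decomposition[of C] by metis
  have tt: "(\<tau> ** \<tau>) $ c $ c' = S c c'" for c c'
    unfolding \<tau>(2) S_def trace_def by (simp add: T_def matrix_mult_nth sum_UNIV_prod) (rule sum.swap)
  have PP: "(P ** P) $ (c, l) $ (c', l') = (dagger (K c) ** K c') $ l $ l'" for c l c' l'
    unfolding P(3) by (simp add: C_def matrix_mult_nth)
  \<comment> \<open>\<open>\<tau>\<close> tensored with \<open>1 / sqrt d\<close>, so that the
    square is \<open>S\<close> tensored with \<open>1 / d\<close>.\<close>
  define B :: "complex^('k \<times> 'l)^('k \<times> 'l)" where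
    "B = (\<chi> p q. if snd p = snd q then \<tau> $ fst p $ fst q / of_real (sqrt d) else 0)"
  have B: "B $ (c, l) $ (c', l') = (if l = l' then \<tau> $ c $ c' / of_real (sqrt d) else 0)" for c l c' l'
    by (simp add: B_def)
  have psdB: "psd B" by (rule psd_tensor_id[OF \<tau>(1) _ B]) (use d in simp)
  have BB: "(B ** B) $ (c, l) $ (c', l') = (if l = l' then S c c' / of_real d else 0)" for c l c' l'
  proof -
    have "(B ** B) $ (c, l) $ (c', l') = (\<Sum>c''\<in>UNIV. \<Sum>l''\<in>UNIV. if l = l'' then
        \<tau> $ c $ c'' / of_real (sqrt d) * B $ (c'', l'') $ (c', l') else 0)"
      unfolding matrix_mult_nth[of B] sum_UNIV_prod by (intro sum.cong refl) (simp add: B)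
    also have "\<dots> = (if l = l' then (\<Sum>c''\<in>UNIV. \<tau> $ c $ c'' * \<tau> $ c'' $ c') / of_real d else 0)"
      by (simp add: B sd sum_divide_distrib)
    finally show ?thesis by (simp add: tt[symmetric] matrix_mult_nth)
  qed
  define D where "D = P - B"
  have hP: "dagger P = P" and hB: "dagger B = B" and h\<tau>: "dagger \<tau> = \<tau>"
    using psd_hermitian P(1) psdB \<tau>(1) by auto
  have hD: "dagger D = D" by (simp add: D_def dagger_diff hP hB)

  have trS: "(\<Sum>c\<in>UNIV. S c c) = of_real d"
    unfolding S_def trace_sum[symmetric] TP by (simp add: trace_I d_def)
  have trPP: "trace (P ** P) = of_real d"
  proof -
    have "trace (P ** P) = (\<Sum>c\<in>UNIV. S c c)"
      by (simp add: trace_def[of "P ** P"] sum_UNIV_prod PP S_def trace_def[of "dagger _ ** _"])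
    then show ?thesis by (simp add: trS)
  qed
  have trBB: "trace (B ** B) = of_real d"
  proof -
    have "trace (B ** B) = of_nat CARD('l) * (\<Sum>c\<in>UNIV. S c c) / of_real d"
      by (simp add: trace_def[of "B ** B"] sum_UNIV_prod BB sum_distrib_left sum_divide_distrib)
    then show ?thesis using d unfolding trS by (simp add: d_def)
  qed
  have SS: "S c c' * S c' c = of_real ((cmod (S c c'))\<^sup>2)" for c c'
  proof -
    have "S c' c = cnj (S c c')"
      unfolding S_def trace_dagger[symmetric] by (simp add: dagger_mult)
    then show ?thesis by (simp add: mult_cnj_cmod)
  qed

  \<comment> \<open>\<open>tr (P^2 B^2)\<close> and \<open>tr (B^4)\<close> both equal the sum of
    the \<open>|S c c'|^2\<close> divided by \<open>d\<close>; so twice the cross term and the last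
    term combine to a single subtraction.\<close>
  have Y: "Re (trace ((P ** P - B ** B) ** (P ** P - B ** B))) = Y"
  proof -
    have "trace ((P ** P) ** (P ** P)) = trace ((C ** dagger C) ** (C ** dagger C))"
      unfolding P(3) using trace_mul_sym[of "dagger C" "C ** dagger C ** C"] by (simp add: matrix_mul_assoc)
    moreover have "C ** dagger C = \<Lambda> (mat 1)"
      by (simp add: \<Lambda> vec_eq_iff sum_component C_def matrix_mult_nth sum_UNIV_prod)
    ultimately have 1: "trace ((P ** P) ** (P ** P)) = trace (\<Lambda> (mat 1) ** \<Lambda> (mat 1))" by simp
    have "trace ((P ** P) ** (B ** B)) = (\<Sum>c\<in>UNIV. \<Sum>l\<in>UNIV. \<Sum>c'\<in>UNIV. \<Sum>l'\<in>UNIV.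
        if l' = l then (dagger (K c) ** K c') $ l $ l' * (S c' c / of_real d) else 0)"
      unfolding trace_def matrix_mult_nth[of "P ** P"] sum_UNIV_prod PP BB by (intro sum.cong refl) simp
    also have "\<dots> = (\<Sum>c\<in>UNIV. \<Sum>c'\<in>UNIV. \<Sum>l\<in>UNIV. (dagger (K c) ** K c') $ l $ l * (S c' c / of_real d))"
      by (simp, intro sum.cong refl sum.swap)
    also have "\<dots> = (\<Sum>c\<in>UNIV. \<Sum>c'\<in>UNIV. S c c' * S c' c / of_real d)"
    proof (intro sum.cong refl)
      fix c c'
      show "(\<Sum>l\<in>UNIV. (dagger (K c) ** K c') $ l $ l * (S c' c / of_real d)) = S c c' * S c' c / of_real d"
        by (simp add: S_def[of c c'] trace_def sum_distrib_right sum_divide_distrib)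
    qed
    also have "\<dots> = of_real (1 / d * (\<Sum>c\<in>UNIV. \<Sum>c'\<in>UNIV. (cmod (S c c'))\<^sup>2))"
      by (simp add: SS sum_distrib_left)
    finally have 2: "trace ((P ** P) ** (B ** B)) = of_real (1 / d * (\<Sum>c\<in>UNIV. \<Sum>c'\<in>UNIV. (cmod (S c c'))\<^sup>2))" .
    have "trace ((B ** B) ** (B ** B)) = (\<Sum>c\<in>UNIV. \<Sum>l\<in>(UNIV :: 'l set). \<Sum>c'\<in>UNIV. \<Sum>l'\<in>UNIV.
        if l' = l then S c c' * S c' c / (of_real d * of_real d) else 0)"
      unfolding trace_def matrix_mult_nth[of "B ** B"] sum_UNIV_prod BB
      by (rule sum.cong[OF refl])+ simp
    also have "\<dots> = of_real (1 / d * (\<Sum>c\<in>UNIV. \<Sum>c'\<in>UNIV. (cmod (S c c'))\<^sup>2))"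
    proof -
      have "complex_of_nat CARD('l) = of_real d" by (simp add: d_def)
      then show ?thesis using d by (simp add: SS sum_distrib_left)
    qed
    finally have 3: "trace ((B ** B) ** (B ** B)) = of_real (1 / d * (\<Sum>c\<in>UNIV. \<Sum>c'\<in>UNIV. (cmod (S c c'))\<^sup>2))" .
    have "trace ((P ** P - B ** B) ** (P ** P - B ** B)) =
        trace ((P ** P) ** (P ** P)) - 2 * trace ((P ** P) ** (B ** B)) + trace ((B ** B) ** (B ** B))"
      using trace_mul_sym[of "B ** B" "P ** P"] by (simp add: matrix_diff_ldistrib matrix_diff_rdistrib trace_sub)
    then show ?thesis unfolding 1 2 3 Y_def by simp
  qed

  \<comment> \<open>A zero \<open>K c\<close> makes these diagonal entries vanish, and with them the
    rows of \<open>\<tau>\<close> and \<open>P\<close>; hence \<open>D\<close> lives on at most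
    \<open>N d\<close> indices.\<close>
  have "(\<tau> ** \<tau>) $ c $ c = 0 \<and> (P ** P) $ (c, l) $ (c, l) = 0" if "K c = 0" for c l
    unfolding tt PP S_def using that by (simp add: trace_def matrix_mult_nth)
  then have D0: "D $ p $ q = 0" if "p \<notin> {c. K c \<noteq> 0} \<times> UNIV" for p q
    using that hermitian_square_diag_zero[OF h\<tau>, of "fst p" "fst q"] hermitian_square_diag_zero[OF hP, of p q]
    by (cases p; cases q) (auto simp: D_def B)
  have "Re (trace (D ** D)) \<le> sqrt (card ({c. K c \<noteq> 0} \<times> (UNIV :: 'l set))) * sqrt (Re (trace ((D ** D) ** (D ** D))))"
    by (rule trace_square_le[OF hD D0])
  also have "\<dots> \<le> sqrt (real N * d) * sqrt Y"
  proof (intro mult_mono real_sqrt_le_mono)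
    show "Re (trace ((D ** D) ** (D ** D))) \<le> Y"
      using trace_diff_pow4_le[OF P(1) psdB] by (simp add: D_def Y)
    have "0 \<le> Re (trace (dagger (D ** D) ** (D ** D)))"
      unfolding trace_dagger_mult_self Re_complex_of_real by (simp add: sum_nonneg)
    then show "0 \<le> sqrt (Re (trace ((D ** D) ** (D ** D))))" by (simp add: dagger_mult hD)
    show "real (card ({c. K c \<noteq> 0} \<times> (UNIV :: 'l set))) \<le> real N * d"
      using N by (simp add: card_cartesian_product d_def mult_right_mono)
  qed (use d in simp)
  finally have DD: "Re (trace (D ** D)) \<le> sqrt (real N * d) * sqrt Y" .
  \<comment> \<open>\<open>P ** P\<close> and \<open>B ** B\<close> both have trace
    \<open>d\<close>, so an upper bound on the distance of \<open>P\<close> and \<open>B\<close> is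
    a lower bound on their overlap.\<close>
  have "trace (D ** D) = of_real (2 * d) - 2 * trace (P ** B)"
    using trace_mul_sym[of B P] trPP trBB
    by (simp add: D_def matrix_diff_ldistrib matrix_diff_rdistrib trace_sub)
  with DD have PB: "d - sqrt (real N * d) * sqrt Y / 2 \<le> Re (trace (P ** B))" by simp

  \<comment> \<open>\<open>w c c'\<close> is the trace of the recovery operator from block
    \<open>c\<close> of \<open>W\<close> times \<open>K c'\<close>; the polar form
    \<open>P = W ** C\<close> turns \<open>tr (P B)\<close> into a pairing of \<open>w\<close> with
    \<open>\<tau> / sqrt d\<close>.\<close>
  define w where "w c c' = (\<Sum>l\<in>UNIV. \<Sum>s\<in>UNIV. W $ (c, l) $ s * K c' $ s $ l)" for c c'
  have "trace (P ** B) = (\<Sum>c\<in>UNIV. \<Sum>c'\<in>UNIV. w c c' * (\<tau> $ c' $ c / of_real (sqrt d)))"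
  proof -
    have "trace (P ** B) = (\<Sum>c\<in>UNIV. \<Sum>l\<in>UNIV. \<Sum>c'\<in>UNIV. \<Sum>l'\<in>UNIV.
        if l' = l then P $ (c, l) $ (c', l') * (\<tau> $ c' $ c / of_real (sqrt d)) else 0)"
      unfolding trace_def matrix_mult_nth[of P] sum_UNIV_prod B by (intro sum.cong refl) simp
    also have "\<dots> = (\<Sum>c\<in>UNIV. \<Sum>c'\<in>UNIV. \<Sum>l\<in>UNIV. P $ (c, l) $ (c', l) * (\<tau> $ c' $ c / of_real (sqrt d)))"
      by (simp, intro sum.cong refl sum.swap)
    also have "\<dots> = (\<Sum>c\<in>UNIV. \<Sum>c'\<in>UNIV. w c c' * (\<tau> $ c' $ c / of_real (sqrt d)))"
      unfolding P(2) w_def sum_distrib_right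
      by (simp add: matrix_mult_nth C_def sum_distrib_right sum_divide_distrib)
    finally show ?thesis .
  qed
  then have "cmod (trace (P ** B)) \<le> sqrt (\<Sum>p\<in>UNIV. (cmod (w (fst p) (snd p)))\<^sup>2) *
      sqrt (\<Sum>p\<in>UNIV. (cmod (\<tau> $ snd p $ fst p / of_real (sqrt d)))\<^sup>2)"
    using cmod_sum_mult_le[of "\<lambda>p. w (fst p) (snd p)" "\<lambda>p. \<tau> $ snd p $ fst p / of_real (sqrt d)" UNIV]
    by (simp add: sum_UNIV_prod)
  \<comment> \<open>The normalisation \<open>tr (\<tau>^2) = tr S = d\<close> makes this
    Cauchy-Schwarz factor equal to 1.\<close>
  also have "(\<Sum>p\<in>UNIV. (cmod (\<tau> $ snd p $ fst p / of_real (sqrt d)))\<^sup>2) = 1"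
  proof -
    have "complex_of_real (\<Sum>c\<in>UNIV. \<Sum>c'\<in>UNIV. (cmod (\<tau> $ c $ c'))\<^sup>2) = trace (\<tau> ** \<tau>)"
      unfolding trace_dagger_mult_self[symmetric] h\<tau> ..
    also have "\<dots> = of_real d" by (simp add: trace_def tt trS)
    finally have "(\<Sum>c\<in>UNIV. \<Sum>c'\<in>UNIV. (cmod (\<tau> $ c $ c'))\<^sup>2) = d" by (simp only: of_real_eq_iff)
    then have "(\<Sum>c'\<in>UNIV. \<Sum>c\<in>UNIV. (cmod (\<tau> $ c $ c'))\<^sup>2) = d" by (subst sum.swap)
    then show ?thesis
      using d by (simp add: sum_UNIV_prod norm_divide power_divide flip: sum_divide_distrib)
  qed
  finally have "Re (trace (P ** B)) \<le> sqrt (\<Sum>p\<in>UNIV. (cmod (w (fst p) (snd p)))\<^sup>2)"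
    using complex_Re_le_cmod[of "trace (P ** B)"] by simp
  then have "(d - sqrt (real N * d) * sqrt Y / 2) / d \<le> sqrt (\<Sum>p\<in>UNIV. (cmod (w (fst p) (snd p)))\<^sup>2) / d"
    using PB d by (intro divide_right_mono) simp_all
  also have "\<dots> \<le> recovery_fidelity \<Lambda>"
    using recovery_from_contraction[OF \<Lambda> W] by (simp add: sum_UNIV_prod w_def d_def)
  finally have "(d - sqrt (real N * d) * sqrt Y / 2) / d \<le> recovery_fidelity \<Lambda>" .
  moreover have "sqrt (real N * d) / 2 / d = sqrt (real N / (4 * d))"
  proof -
    have "sqrt (real N / (4 * d)) = sqrt (real N * d / (2 * d)\<^sup>2)"
      using d by (simp add: power2_eq_square field_simps)
    also have "\<dots> = sqrt (real N * d) / (2 * d)"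
      unfolding real_sqrt_divide real_sqrt_abs using d by simp
    finally show ?thesis by simp
  qed
  then have "(d - sqrt (real N * d) * sqrt Y / 2) / d = 1 - sqrt (real N / (4 * d)) * sqrt Y"
    using d by (simp add: diff_divide_distrib flip: times_divide_eq_left)
  ultimately show ?thesis by (simp add: Y_def S_def)
qed

section \<open>Invariance under the choice of Kraus operators\<close>

text \<open>The Choi matrix of the map with Kraus operators \<open>K a\<close>, built from the
  vectorised \<open>K a\<close>. Families with the same Choi matrix define the same map.\<close>

definition kraus_choi :: "('i \<Rightarrow> complex^'l::finite^'s::finite) \<Rightarrow> 'i set \<Rightarrow> complex^('s \<times> 'l)^('s \<times> 'l)" where
  "kraus_choi K I = (\<Sum>a\<in>I. ketbra (\<chi> p. K a $ fst p $ snd p))"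

lemma kraus_choi_nth:
  "kraus_choi K I $ (s, l) $ (s', l') = (\<Sum>a\<in>I. K a $ s $ l * cnj (K a $ s' $ l'))"
  by (simp add: kraus_choi_def sum_component)

lemma kraus_map_choi:
  "(\<Sum>a\<in>I. K a ** X ** dagger (K a)) $ s $ s' =
    (\<Sum>l'\<in>UNIV. \<Sum>l\<in>UNIV. X $ l $ l' * kraus_choi K I $ (s, l) $ (s', l'))"
proof -
  have "(\<Sum>a\<in>I. K a ** X ** dagger (K a)) $ s $ s' =
      (\<Sum>a\<in>I. \<Sum>l'\<in>UNIV. \<Sum>l\<in>UNIV. X $ l $ l' * (K a $ s $ l * cnj (K a $ s' $ l')))"
    by (simp add: sum_component matrix_mult_nth sum_distrib_left sum_distrib_right mult_ac)
  also have "\<dots> = (\<Sum>l'\<in>UNIV. \<Sum>l\<in>UNIV. \<Sum>a\<in>I. X $ l $ l' * (K a $ s $ l * cnj (K a $ s' $ l')))"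
    by (subst sum.swap, intro sum.cong refl sum.swap)
  finally show ?thesis by (simp add: kraus_choi_nth sum_distrib_left)
qed

lemma kraus_trace_choi:
  "(\<Sum>a\<in>I. dagger (K a) ** K a) $ l $ l' = (\<Sum>s\<in>UNIV. kraus_choi K I $ (s, l') $ (s, l))"
  by (simp add: sum_component matrix_mult_nth kraus_choi_nth mult.commute) (rule sum.swap)

text \<open>If \<open>T\<close> has the vectorised \<open>K a\<close> as columns, the two sides are
  the squared Hilbert-Schmidt norms of \<open>dagger T ** T\<close> and
  \<open>T ** dagger T\<close>, which agree by cyclicity of the trace.\<close>

lemma kraus_gram_choi:
  "(\<Sum>a\<in>I. \<Sum>b\<in>I. (cmod (trace (dagger (K a) ** K b)))\<^sup>2) =
    (\<Sum>p\<in>UNIV. \<Sum>q\<in>UNIV. (cmod (kraus_choi K I $ p $ q))\<^sup>2)"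
proof -
  define k where "k a p = K a $ fst p $ snd p" for a p
  have J: "kraus_choi K I $ p $ q = (\<Sum>a\<in>I. k a p * cnj (k a q))" for p q
    by (simp add: kraus_choi_def sum_component k_def)
  have tr: "trace (dagger (K a) ** K b) = (\<Sum>p\<in>UNIV. cnj (k a p) * k b p)" for a b
    by (simp add: trace_def matrix_mult_nth sum_UNIV_prod k_def) (rule sum.swap)
  have "complex_of_real (\<Sum>a\<in>I. \<Sum>b\<in>I. (cmod (trace (dagger (K a) ** K b)))\<^sup>2) =
      (\<Sum>a\<in>I. \<Sum>b\<in>I. \<Sum>p\<in>UNIV. \<Sum>q\<in>UNIV. (cnj (k a p) * k b p) * (k a q * cnj (k b q)))"
    by (simp add: mult_cnj_cmod(1)[symmetric] tr sum_product)
  also have "\<dots> = (\<Sum>a\<in>I. \<Sum>p\<in>UNIV. \<Sum>b\<in>I. \<Sum>q\<in>UNIV. (cnj (k a p) * k b p) * (k a q * cnj (k b q)))"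
    by (intro sum.cong refl sum.swap)
  also have "\<dots> = (\<Sum>p\<in>UNIV. \<Sum>a\<in>I. \<Sum>q\<in>UNIV. \<Sum>b\<in>I. (cnj (k a p) * k b p) * (k a q * cnj (k b q)))"
    by (subst sum.swap, intro sum.cong refl sum.swap)
  also have "\<dots> = (\<Sum>p\<in>UNIV. \<Sum>q\<in>UNIV. \<Sum>a\<in>I. \<Sum>b\<in>I. (cnj (k a p) * k b p) * (k a q * cnj (k b q)))"
    by (intro sum.cong refl sum.swap)
  also have "\<dots> = (\<Sum>p\<in>UNIV. \<Sum>q\<in>UNIV. kraus_choi K I $ p $ q * cnj (kraus_choi K I $ p $ q))"
    unfolding J cnj_sum sum_product
    by (rule sum.cong[OF refl], rule sum.cong[OF refl], subst sum.swap) (simp add: mult_ac)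
  also have "\<dots> = of_real (\<Sum>p\<in>UNIV. \<Sum>q\<in>UNIV. (cmod (kraus_choi K I $ p $ q))\<^sup>2)"
    by (simp add: mult_cnj_cmod)
  finally show ?thesis by (simp only: of_real_eq_iff)
qed

text \<open>The map, the trace condition and the Gram sum depend on the family only through its Choi
  matrix. So the family can be exchanged for one indexed by \<open>'s \<times> 'l\<close> with at
  most \<open>card I\<close> nonzero members.\<close>

lemma recovery_fidelity_kraus_family_bound:
  fixes K :: "'i \<Rightarrow> complex^'l::finite^'s::finite"
  assumes I: "finite I"
    and \<Lambda>: "\<And>X. \<Lambda> X = (\<Sum>a\<in>I. K a ** X ** dagger (K a))"
    and TP: "(\<Sum>a\<in>I. dagger (K a) ** K a) = mat 1"
  defines "d \<equiv> real CARD('l)"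
  shows "1 - sqrt (real (card I) / (4 * d)) * sqrt (Re (trace (\<Lambda> (mat 1) ** \<Lambda> (mat 1)))
      - 1 / d * (\<Sum>a\<in>I. \<Sum>b\<in>I. (cmod (trace (dagger (K a) ** K b)))\<^sup>2))
    \<le> recovery_fidelity \<Lambda>"
proof -
  obtain v :: "'s \<times> 'l \<Rightarrow> complex^('s \<times> 'l)" where
    v: "(\<Sum>c\<in>UNIV. ketbra (v c)) = (\<Sum>a\<in>I. ketbra (\<chi> p. K a $ fst p $ snd p))"
    and card: "card {c. v c \<noteq> 0} \<le> card I"
    by (rule ketbra_sum_reindex[OF I])
  define K' :: "'s \<times> 'l \<Rightarrow> complex^'l^'s" where "K' c = (\<chi> s l. v c $ (s, l))" for c
  have J: "kraus_choi K' UNIV = kraus_choi K I"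
    unfolding kraus_choi_def v[symmetric] by (intro sum.cong refl arg_cong[of _ _ ketbra]) (simp add: K'_def vec_eq_iff)
  have "\<Lambda> X = (\<Sum>c\<in>UNIV. K' c ** X ** dagger (K' c))" for X
    unfolding \<Lambda> vec_eq_iff kraus_map_choi J by simp
  moreover have "(\<Sum>c\<in>UNIV. dagger (K' c) ** K' c) = mat 1"
    unfolding TP[symmetric] vec_eq_iff kraus_trace_choi J by simp
  moreover have "{c. K' c \<noteq> 0} = {c. v c \<noteq> 0}" by (auto simp: K'_def vec_eq_iff)
  ultimately show ?thesis
    using recovery_fidelity_kraus_bound[of \<Lambda> K' "card I"] card
    unfolding d_def kraus_gram_choi J by simp
qed

section \<open>The bound for the composed channel\<close>

theorem mainTheorem1:
  fixes \<E> :: "complex^'l^'l \<Rightarrow> complex^'s^'s"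
    and \<N> :: "complex^'s^'s \<Rightarrow> complex^'s^'s"
    and E :: "nat \<Rightarrow> complex^'l^'s"
    and A :: "nat \<Rightarrow> complex^'s^'s"
    and m n :: nat
  assumes "channel \<E>"
    and "channel \<N>"
    and "\<And>\<rho>. \<E> \<rho> = (\<Sum>s = 1..m. E s ** \<rho> ** dagger (E s))"
    and "\<And>\<sigma>. \<N> \<sigma> = (\<Sum>i = 1..n. A i ** \<sigma> ** dagger (A i))"
    and "(\<Sum>s = 1..m. dagger (E s) ** E s) = mat 1"
    and "(\<Sum>i = 1..n. dagger (A i) ** A i) = mat 1"
  shows "recovery_fidelity (\<N> \<circ> \<E>) \<ge> 1 - infidelity m E n A"
proof -
  define d where "d = real CARD('l)"
  define I where "I = {1..n} \<times> {1..m}"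
  define K where "K a = A (fst a) ** E (snd a)" for a
  define Q where "Q = (\<Sum>s = 1..m. E s ** dagger (E s))"
  have sumI: "(\<Sum>a\<in>I. f a) = (\<Sum>i = 1..n. \<Sum>s = 1..m. f (i, s))" for f :: "_ \<Rightarrow> 'c::comm_monoid_add"
    by (simp add: I_def sum.cartesian_product)
  have \<Lambda>: "(\<N> \<circ> \<E>) X = (\<Sum>a\<in>I. K a ** X ** dagger (K a))" for X
    by (simp add: assms(3,4) sumI K_def dagger_mult matrix_mult_sum_left matrix_mult_sum_right matrix_mul_assoc)
  have "(\<Sum>a\<in>I. dagger (K a) ** K a) = (\<Sum>s = 1..m. \<Sum>i = 1..n. dagger (E s) ** (dagger (A i) ** A i) ** E s)"
    unfolding sumI by (subst sum.swap) (simp add: K_def dagger_mult matrix_mul_assoc)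
  also have "\<dots> = mat 1"
    by (simp only: assms(5,6) matrix_mult_sum_left[symmetric] matrix_mult_sum_right[symmetric] matrix_mul_rid)
  finally have TP: "(\<Sum>a\<in>I. dagger (K a) ** K a) = mat 1" .
  have \<Lambda>1: "(\<N> \<circ> \<E>) (mat 1) = (\<Sum>i = 1..n. A i ** Q ** dagger (A i))"
    by (simp add: assms(3,4) Q_def)
  \<comment> \<open>Cyclicity moves \<open>dagger (A i)\<close> to the front, which turns the trace
    of the squared image of the identity into the first sum of the infidelity.\<close>
  have "trace ((\<N> \<circ> \<E>) (mat 1) ** (\<N> \<circ> \<E>) (mat 1)) =
      (\<Sum>i = 1..n. \<Sum>j = 1..n. trace ((A j ** Q ** dagger (A j)) ** (A i ** Q ** dagger (A i))))"
    unfolding \<Lambda>1 by (simp add: matrix_mult_sum_left matrix_mult_sum_right trace_sum)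
  also have "\<dots> = (\<Sum>i = 1..n. \<Sum>j = 1..n. trace (dagger (A i) ** A j ** Q ** dagger (A j) ** A i ** Q))"
  proof (intro sum.cong refl)
    fix i j
    show "trace ((A j ** Q ** dagger (A j)) ** (A i ** Q ** dagger (A i))) =
        trace (dagger (A i) ** A j ** Q ** dagger (A j) ** A i ** Q)"
      using trace_mul_sym[of "A j ** Q ** dagger (A j) ** A i ** Q" "dagger (A i)"]
      by (simp add: matrix_mul_assoc)
  qed
  finally have purity: "trace ((\<N> \<circ> \<E>) (mat 1) ** (\<N> \<circ> \<E>) (mat 1)) =
      (\<Sum>i = 1..n. \<Sum>j = 1..n. trace (dagger (A i) ** A j ** Q ** dagger (A j) ** A i ** Q))" .
  have "(\<Sum>a\<in>I. \<Sum>b\<in>I. (cmod (trace (dagger (K a) ** K b)))\<^sup>2) =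
      (\<Sum>i = 1..n. \<Sum>s = 1..m. \<Sum>j = 1..n. \<Sum>t = 1..m. (cmod (trace (dagger (A i) ** A j ** E t ** dagger (E s))))\<^sup>2)"
    unfolding sumI
  proof (intro sum.cong refl)
    fix i s j t
    have "trace (dagger (K (i, s)) ** K (j, t)) = trace (dagger (A i) ** A j ** E t ** dagger (E s))"
      using trace_mul_sym[of "dagger (E s)" "dagger (A i) ** A j ** E t"]
      by (simp add: K_def dagger_mult matrix_mul_assoc)
    then show "(cmod (trace (dagger (K (i, s)) ** K (j, t))))\<^sup>2 =
        (cmod (trace (dagger (A i) ** A j ** E t ** dagger (E s))))\<^sup>2" by simp
  qed
  also have "\<dots> = (\<Sum>i = 1..n. \<Sum>j = 1..n. \<Sum>s = 1..m. \<Sum>t = 1..m. (cmod (trace (dagger (A i) ** A j ** E t ** dagger (E s))))\<^sup>2)"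
    by (intro sum.cong refl sum.swap)
  finally have gram: "(\<Sum>a\<in>I. \<Sum>b\<in>I. (cmod (trace (dagger (K a) ** K b)))\<^sup>2) =
      (\<Sum>i = 1..n. \<Sum>j = 1..n. \<Sum>s = 1..m. \<Sum>t = 1..m. (cmod (trace (dagger (A i) ** A j ** E t ** dagger (E s))))\<^sup>2)" .
  \<comment> \<open>The factor \<open>m * n\<close> is the cardinality of \<open>I\<close>.\<close>
  have inf: "infidelity m E n A = sqrt (real (card I) / (4 * d)) * sqrt (Re (trace ((\<N> \<circ> \<E>) (mat 1) ** (\<N> \<circ> \<E>) (mat 1)))
      - 1 / d * (\<Sum>a\<in>I. \<Sum>b\<in>I. (cmod (trace (dagger (K a) ** K b)))\<^sup>2))"
    unfolding infidelity_def Let_def purity gram Q_def d_def by (simp add: I_def mult.commute)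
  have "finite I" by (simp add: I_def)
  from recovery_fidelity_kraus_family_bound[OF this \<Lambda> TP] show ?thesis
    unfolding inf d_def .
qed

end
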